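(* For every $n\in\mathbb N$ we have $p^{(k+1)}_n\sim p^{(k)}_n\log p^{(k)}_n$ as $k\to+\infty$.
   Context: Let $p_n$ denote the $n$-th prime number. Define $p^{(0)}_n=n$ and recursively $p^{(k+1)}_n=p_{p^{(k)}_n}$ for $k\in\mathbb N_0$. $\log$ is the natural logarithm and $a_k\sim b_k$ means $a_k/b_k\to1$. *)

theory Defs
  imports "HOL-Analysis.Analysis" "HOL-Computational_Algebra.Primes" "HOL-Library.Landau_Symbols"
begin

text \<open>The n-th prime p_n, 1-indexed: p_1 = 2, p_2 = 3, ...
  (enumerate is 0-indexed, hence the shift; the value at n = 0 is irrelevant.)\<close>
definition nth_prime :: "nat \<Rightarrow> nat" where
  "nth_prime n = enumerate {p::nat. prime p} (n - 1)"

definition iter_prime :: "nat \<Rightarrow> nat \<Rightarrow> nat" where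
  "iter_prime k n = (nth_prime ^^ k) n"

end

(*
  Newman's analytic proof of the prime number theorem, applied along the orbit of the map n |-> p_n.

  Write psi for the Chebyshev function and b_n = (psi n - n) / n, which is bounded by Chebyshev's
  binomial coefficient argument. Summation by parts gives, for Re s > 1,
    s * (sum b_n n^(-s)) = -zeta'(s)/zeta(s) - zeta(s) + (a series holomorphic for Re s > 0),
  and since zeta has no zeros on Re s >= 1 (log zeta has nonnegative coefficients and
  3 + 4 cos x + cos 2x >= 0) the right-hand side extends holomorphically to a neighbourhood of
  Re s >= 1. Newman's contour integral then shows that the sum of b_n / n converges, which for the
  monotone function psi forces psi n ~ n, hence p_m ~ m log m. As the iterates tend to infinity,
  this is the claim.
*)
theory Submission
  imports Defs "HOL-Complex_Analysis.Complex_Analysis" "HOL-Number_Theory.Prime_Powers"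
    "HOL-Real_Asymp.Real_Asymp"
begin

subsection \<open>Newman's Tauberian theorem for Dirichlet series\<close>

text \<open>Newman's method needs bounded coefficients, which \<open>(psi n - n) / n\<close> has and
  \<open>mangoldt\<close> has not. Convergence of the sum of \<open>(psi n - n) / n^2\<close> is
  also strong enough: a monotone function that strays from \<open>n\<close> by a fixed proportion
  does so on a whole interval of proportional length and contributes a fixed amount there. On a
  circle of radius \<open>R\<close> about the critical point, the tail (right half) and the partial
  sum (left half) have size about \<open>N^(- Re w) / |Re w|\<close>, which is unbounded near the
  imaginary axis. The kernel \<open>N^w * (1 + w^2 / R^2)\<close> has norm
  \<open>N^(Re w) * 2 * |Re w| / R\<close> there and cancels both factors, so that
  \<open>O(1 / R)\<close> remains. The limit function itself is integrated over the right half
  circle only, so its behaviour left of the axis never has to be estimated. The pole of zeta at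
  \<open>1\<close> is the other obstacle. The simple poles of \<open>- zeta' / zeta\<close> and of
  \<open>zeta\<close> have the same residue and cancel in the difference. To make this visible,
  everything is expressed through \<open>(s - 1) * zeta s\<close>, which is holomorphic for
  \<open>Re s > 0\<close> and has the value \<open>1\<close> at \<open>1\<close>.\<close>

lemma norm_nat_powr:
  "norm ((of_nat n :: complex) powr s) = real n powr Re s"
  by (simp add: norm_powr_real_powr)

lemma nat_powr_tail_term_le:
  fixes x :: real
  assumes "x > 0" "n > 0"
  shows "real (Suc n) powr (-x - 1) \<le> (real n powr (-x) - real (Suc n) powr (-x)) / x"
proof -
  have "\<exists>z. real n < z \<and> z < real (Suc n) \<and>
      real (Suc n) powr (-x) - real n powr (-x) = (real (Suc n) - real n) * ((-x) * z powr (-x - 1))"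
    by (rule MVT2) (use assms in \<open>auto intro!: derivative_eq_intros\<close>)
  then obtain z where z: "real n < z" "z < real (Suc n)"
     "real (Suc n) powr (-x) - real n powr (-x) = - x * z powr (-x - 1)" by auto
  have "real (Suc n) powr (-x - 1) \<le> z powr (-x - 1)"
    using z assms by (intro powr_mono2') auto
  also have "\<dots> = (real n powr (-x) - real (Suc n) powr (-x)) / x"
    using z assms by (simp add: field_simps)
  finally show ?thesis .
qed

text \<open>Each term is compared with the unit interval to its left, and the comparison series
  telescopes. The tail therefore starts at \<open>Suc N\<close> and the bound is the exact integral
  from \<open>N\<close>, whose factor \<open>1 / x\<close> the zeros of Newman's kernel will
  absorb.\<close>

lemma suminf_nat_powr_tail_le:
  fixes x :: real
  assumes "x > 0" "N > 0"
  shows "summable (\<lambda>n. real (n + Suc N) powr (-x - 1))"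
    and "(\<Sum>n. real (n + Suc N) powr (-x - 1)) \<le> real N powr (-x) / x"
proof -
  let ?t = "\<lambda>n. (real (n + N) powr (-x) - real (Suc n + N) powr (-x)) / x"
  have "(\<lambda>n. real (n + N) powr (-x)) \<longlonglongrightarrow> 0"
    using assms by (intro tendsto_neg_powr filterlim_compose[OF filterlim_real_sequentially] filterlim_add_const_nat_at_top) auto
  from telescope_sums'[OF this] have s: "?t sums (real N powr (-x) / x)"
    by (intro sums_divide) simp
  have le: "real (n + Suc N) powr (-x - 1) \<le> ?t n" for n
    using nat_powr_tail_term_le[of x "n + N"] assms by (simp add: add_ac)
  show sm: "summable (\<lambda>n. real (n + Suc N) powr (-x - 1))"
    using le by (intro summable_comparison_test'[OF sums_summable[OF s], of 0]) auto
  show "(\<Sum>n. real (n + Suc N) powr (-x - 1)) \<le> real N powr (-x) / x"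
    using suminf_le[OF le sm sums_summable[OF s]] sums_unique[OF s] by simp
qed

text \<open>For \<open>y <= 1\<close> the terms decrease and each is compared with the interval to
  its left. For \<open>y > 1\<close> they increase, the comparison is with the interval to the
  right, and the last term has to be split off; it is the second summand of the bound.\<close>

lemma sum_nat_powr_le:
  fixes y :: real
  assumes "y > 0" "N > 0"
  shows "(\<Sum>n\<in>{1..N}. real n powr (y - 1)) \<le> real N powr y / y + real N powr (y - 1)"
proof (cases "y \<le> 1")
  case True
  have "(\<Sum>n\<in>{1..N}. real n powr (y - 1)) \<le> real N powr y / y" for N
  proof (induction N)
    case (Suc N)
    have "real (Suc N) powr (y - 1) \<le> (real (Suc N) powr y - real N powr y) / y"
    proof (cases "N = 0")
      case False
      have "\<exists>z. real N < z \<and> z < real (Suc N) \<and>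
        real (Suc N) powr y - real N powr y = (real (Suc N) - real N) * (y * z powr (y - 1))"
        by (rule MVT2) (use False in \<open>auto intro!: derivative_eq_intros\<close>)
      then obtain z where z: "real N < z" "z < real (Suc N)"
        "real (Suc N) powr y - real N powr y = y * z powr (y - 1)" by auto
      have "real (Suc N) powr (y - 1) \<le> z powr (y - 1)"
        using z False True by (intro powr_mono2') auto
      with z assms show ?thesis by (simp add: field_simps)
    qed (use assms True in auto)
    with Suc show ?case by (simp add: diff_divide_distrib)
  qed simp
  from this[of N] show ?thesis by (smt (verit) powr_ge_zero)
next
  case False
  have "(\<Sum>n\<in>{1..<N}. real n powr (y - 1)) \<le> real N powr y / y" if "N > 0" for N
    using that
  proof (induction N rule: nat_induct_non_zero)
    case (Suc N)
    have "\<exists>z. real N < z \<and> z < real (Suc N) \<and>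
        real (Suc N) powr y - real N powr y = (real (Suc N) - real N) * (y * z powr (y - 1))"
      by (rule MVT2) (use Suc in \<open>auto intro!: derivative_eq_intros\<close>)
    then obtain z where z: "real N < z" "z < real (Suc N)"
        "real (Suc N) powr y - real N powr y = y * z powr (y - 1)" by auto
    have "real N powr (y - 1) \<le> z powr (y - 1)"
      using z False by (intro powr_mono2) auto
    also have "\<dots> = (real (Suc N) powr y - real N powr y) / y"
      using z assms by (simp add: field_simps)
    finally have "real N powr (y - 1) \<le> (real (Suc N) powr y - real N powr y) / y" .
    moreover have "{1..<Suc N} = insert N {1..<N}" using Suc by auto
    ultimately show ?case using Suc by (simp add: diff_divide_distrib)
  qed (use assms in simp)
  moreover have "{1..N} = insert N {1..<N}" using assms by auto
  ultimately show ?thesis using assms by simp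
qed

text \<open>On the circle \<open>R^2 = w * cnj w\<close>, so the kernel is
  \<open>(cnj w + w) / cnj w\<close>. It vanishes where the circle meets the imaginary axis, exactly
  where the bounds for the series have a factor \<open>1 / |Re w|\<close>.\<close>

lemma norm_Newman_kernel:
  fixes w :: complex
  assumes "norm w = R" "R > 0"
  shows "norm (1 + w\<^sup>2 / of_real (R\<^sup>2)) = 2 * \<bar>Re w\<bar> / R"
proof -
  have "of_real (R\<^sup>2) = w * cnj w"
    using assms by (metis complex_norm_square)
  then have "(1 + w\<^sup>2 / of_real (R\<^sup>2)) * of_real (R\<^sup>2) = w * (cnj w + w)"
    using assms by (auto simp: field_simps power2_eq_square)
  also have "cnj w + w = of_real (2 * Re w)"
    by (simp add: complex_eq_iff)
  finally have "norm (1 + w\<^sup>2 / of_real (R\<^sup>2)) * R\<^sup>2 = R * (2 * \<bar>Re w\<bar>)"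
    using assms by (metis abs_mult abs_numeral abs_power2 norm_mult norm_of_real)
  then show ?thesis using assms by (simp add: field_simps power2_eq_square)
qed

text \<open>The interval starts at \<open>-pi/2\<close> so that it splits into the right and the left half circle.\<close>
lemma circle_mean_value:
  assumes "f holomorphic_on UNIV" "R > 0"
  shows "((\<lambda>t. f (of_real R * cis t)) has_integral 2 * of_real pi * f 0) {-(pi/2)..3*pi/2}"
proof -
  \<comment> \<open>A quarter turn of the argument moves the starting angle of the circle from
    \<open>0\<close> to \<open>-pi/2\<close>.\<close>
  define g where "g = (\<lambda>u. f (- \<i> * u))"
  have "g holomorphic_on cball 0 R"
    unfolding g_def
    using holomorphic_on_compose_gen[of "\<lambda>u. - \<i> * u" "cball 0 R" f UNIV] assms
    by (auto simp: o_def intro!: holomorphic_intros)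
  then have "((\<lambda>u. g u / (u - 0)) has_contour_integral 2 * of_real pi * \<i> * g 0) (circlepath 0 R)"
    using assms by (intro Cauchy_integral_circlepath_simple) auto
  then have "((\<lambda>t. g (R * cis t) / (R * cis t) * R * \<i> * cis t) has_integral 2 * of_real pi * \<i> * g 0) {0..2*pi}"
    unfolding circlepath_def by (subst (asm) has_contour_integral_part_circlepath_iff) auto
  then have "((\<lambda>t. - \<i> * (g (R * cis t) / (R * cis t) * R * \<i> * cis t)) has_integral - \<i> * (2 * of_real pi * \<i> * g 0)) {0..2*pi}"
    by (rule has_integral_mult_right)
  also have "(\<lambda>t. - \<i> * (g (R * cis t) / (R * cis t) * R * \<i> * cis t)) = (\<lambda>t. f (R * cis (t + - (pi/2))))"
  proof
    fix t
    have "cis (t + - (pi/2)) = - \<i> * cis t"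
      by (subst cis_mult [symmetric]) simp
    then show "- \<i> * (g (R * cis t) / (R * cis t) * R * \<i> * cis t) = f (R * cis (t + - (pi/2)))"
      using assms by (simp add: g_def mult_ac)
  qed
  also have "- \<i> * (2 * of_real pi * \<i> * g 0) = 2 * of_real pi * f 0"
    by (simp add: g_def)
  finally have "((\<lambda>t. f (R * cis (t + - (pi/2)))) has_integral 2 * of_real pi * f 0) (cbox 0 (2*pi))"
    by simp
  from has_integral_affinity[OF this, of 1 "pi/2"] show ?thesis
    by (simp add: algebra_simps)
qed

text \<open>Since \<open>G 0 = 0\<close>, there is no pole at \<open>0\<close>, and the half circle can be moved to its diameter on the
  imaginary axis. There \<open>N powr w\<close> oscillates, and integrating by parts gains a factor \<open>1 / ln N\<close>.\<close>
lemma half_circle_Newman_integral_tendsto_0: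
  assumes U: "open U" "{w. Re w \<ge> 0} \<subseteq> U" and G: "G holomorphic_on U" "G 0 = 0" and "R > 0"
  shows "(\<lambda>N. integral {-(pi/2)..pi/2} (\<lambda>t. G (R * cis t) *
           (of_nat N powr (R * cis t) * (1 + (R * cis t)\<^sup>2 / of_real (R\<^sup>2))))) \<longlonglongrightarrow> 0"
    (is "?I \<longlonglongrightarrow> 0")
proof -
  \<comment> \<open>\<open>G w / w\<close> times Newman's kernel, with the removable singularity at
    \<open>0\<close> filled in.\<close>
  define h where "h = (\<lambda>w. (if w = 0 then deriv G 0 else (G w - G 0) / (w - 0)) * (1 + w\<^sup>2 / of_real (R\<^sup>2)))"
  have h: "h holomorphic_on U"
    unfolding h_def using U G \<open>R > 0\<close>
    by (intro holomorphic_intros pole_lemma) (auto simp: interior_open)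
  have h': "deriv h holomorphic_on U"
    using h U by (intro holomorphic_deriv)
  define a where "a = - \<i> * of_real R"
  define b where "b = \<i> * of_real R"
  define L where "L = linepath a b"
  define C where "C = part_circlepath 0 R (-(pi/2)) (pi/2)"
  define H where "H = {w. Re w \<ge> 0}"
  have C_ends: "pathstart C = a" "pathfinish C = b"
    using cis_conv_exp[of "pi/2"] cis_conv_exp[of "-(pi/2)"]
    by (simp_all add: C_def a_def b_def)
  have L_im: "path_image L \<subseteq> {w. Re w = 0}"
    by (auto simp: L_def a_def b_def closed_segment_def)
  have C_im: "path_image C \<subseteq> H"
    using \<open>R > 0\<close> by (auto simp: C_def H_def path_image_part_circlepath' closed_segment_eq_real_ivl intro!: mult_nonneg_nonneg cos_ge_zero)
  have im_U: "path_image C \<subseteq> U" "path_image L \<subseteq> U"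
  proof -
    have "path_image L \<subseteq> H" using L_im by (auto simp: H_def)
    moreover have "H \<subseteq> U" using U(2) by (simp add: H_def)
    ultimately show "path_image C \<subseteq> U" "path_image L \<subseteq> U" using C_im by blast+
  qed
  have "continuous_on (path_image L) (deriv h)"
    using h' im_U holomorphic_on_imp_continuous_on holomorphic_on_subset by blast
  then have "bounded (deriv h ` path_image L)"
    by (intro compact_imp_bounded compact_continuous_image) (auto simp: L_def)
  then obtain M where M: "M > 0" "\<And>w. w \<in> path_image L \<Longrightarrow> norm (deriv h w) \<le> M"
    by (auto simp: bounded_pos)
  have bound: "norm (?I N) \<le> (norm (h a) + norm (h b) + M * (2 * R)) / ln (real N)" if N: "N \<ge> 2" for N :: nat
  proof -
    define X :: complex where "X = of_nat N"
    define l :: complex where "l = of_real (ln (real N))"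
    have lnX: "Ln X = l" and X: "X \<noteq> 0"
      using N by (simp_all add: X_def l_def Ln_of_nat)
    have l: "l \<noteq> 0"
      using N ln_gt_zero[of "real N"] by (simp add: l_def)
    have hX: "(\<lambda>w. h w * X powr w) holomorphic_on U"
      using h X by (intro holomorphic_intros)
    have intC: "(\<lambda>w. h w * X powr w) contour_integrable_on C"
      using hX U im_U by (intro contour_integrable_holomorphic_simple) (auto simp: C_def)
    have intL: "(\<lambda>w. h w * X powr w) contour_integrable_on L"
      using hX U im_U by (intro contour_integrable_holomorphic_simple) (auto simp: L_def)
    have intL': "(\<lambda>w. deriv h w * X powr w / l) contour_integrable_on L"
      using h h' X l U im_U by (intro contour_integrable_holomorphic_simple[of _ U] holomorphic_intros) (auto simp: L_def)
    \<comment> \<open>\<open>U\<close> may fail to be convex, so Cauchy's theorem is applied on the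
      closed half plane \<open>H\<close>. The diameter \<open>L\<close> lies on its boundary, where
      continuity is enough.\<close>
    have "((\<lambda>w. h w * X powr w) has_contour_integral 0) (C +++ reversepath L)"
    proof (rule Cauchy_theorem_convex[of H _ "{}"])
      show "continuous_on H (\<lambda>w. h w * X powr w)"
        using hX U by (metis H_def holomorphic_on_imp_continuous_on holomorphic_on_subset)
      show "convex H"
        using convex_halfspace_Re_ge[of 0] by (simp add: H_def)
      show "(\<lambda>w. h w * X powr w) field_differentiable at w" if "w \<in> interior H - {}" for w
        using that hX U interior_subset[of H]
        by (auto simp: H_def intro!: holomorphic_on_imp_differentiable_at[of _ U])
      have "path_image L \<subseteq> H" using L_im by (auto simp: H_def)
      then show "path_image (C +++ reversepath L) \<subseteq> H"
        using C_im C_ends by (subst path_image_join) (simp_all add: L_def closed_segment_commute)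
    qed (use C_ends in \<open>auto simp: L_def C_def\<close>)
    then have "contour_integral (C +++ reversepath L) (\<lambda>w. h w * X powr w) = 0"
      by (rule contour_integral_unique)
    then have CL: "contour_integral C (\<lambda>w. h w * X powr w) = contour_integral L (\<lambda>w. h w * X powr w)"
      using contour_integral_join[OF intC contour_integrable_reversepath[OF _ intL]]
        contour_integral_reversepath[of L "\<lambda>w. h w * X powr w"]
      unfolding L_def C_def by simp
    \<comment> \<open>Integration by parts, in the form of the explicit primitive
      \<open>h w * X powr w / l\<close>.\<close>
    have "((\<lambda>w. h w * X powr w + deriv h w * X powr w / l) has_contour_integral
            h (pathfinish L) * X powr pathfinish L / l - h (pathstart L) * X powr pathstart L / l) L"
    proof (rule contour_integral_primitive)
      fix w assume "w \<in> U"
      then have "(h has_field_derivative deriv h w) (at w within U)"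
        using h U by (metis holomorphic_derivI at_within_open)
      moreover have "((\<lambda>w. X powr w) has_field_derivative l * X powr w) (at w within U)"
        using has_field_derivative_at_within[OF has_field_derivative_powr_right[OF X]] lnX by simp
      ultimately show "((\<lambda>w. h w * X powr w / l) has_field_derivative h w * X powr w + deriv h w * X powr w / l) (at w within U)"
        using l by (auto intro!: derivative_eq_intros simp: field_simps)
    qed (use im_U in \<open>auto simp: L_def\<close>)
    then have "((\<lambda>w. (h w * X powr w + deriv h w * X powr w / l) - deriv h w * X powr w / l) has_contour_integral
            (h b * X powr b / l - h a * X powr a / l) - contour_integral L (\<lambda>w. deriv h w * X powr w / l)) L"
      using intL' by (intro has_contour_integral_diff) (auto simp: L_def has_contour_integral_integral)
    then have Leq: "contour_integral L (\<lambda>w. h w * X powr w) =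
        (h b * X powr b / l - h a * X powr a / l) - contour_integral L (\<lambda>w. deriv h w * X powr w / l)"
      by (auto intro: contour_integral_unique)
    have Xab: "norm (X powr w) = 1" if "Re w = 0" for w
      using that N by (simp add: X_def norm_nat_powr)
    have "norm (contour_integral L (\<lambda>w. deriv h w * X powr w / l)) \<le> M / ln (real N) * norm (b - a)"
      unfolding L_def
    proof (rule contour_integral_bound_linepath)
      fix w assume "w \<in> closed_segment a b"
      then have "w \<in> path_image L" by (simp add: L_def)
      then show "norm (deriv h w * X powr w / l) \<le> M / ln (real N)"
        using M L_im Xab N by (auto simp: norm_mult norm_divide l_def intro!: divide_right_mono)
    qed (use intL' M N in \<open>auto simp: L_def\<close>)
    also have "norm (b - a) = 2 * R"
      using \<open>R > 0\<close> by (simp add: a_def b_def norm_mult flip: mult_2 distrib_left)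
    finally have 1: "norm (contour_integral L (\<lambda>w. deriv h w * X powr w / l)) \<le> M * (2 * R) / ln (real N)"
      by simp
    have 2: "norm (h b * X powr b / l) = norm (h b) / ln (real N)" "norm (h a * X powr a / l) = norm (h a) / ln (real N)"
      using N Xab[of a] Xab[of b] by (auto simp: norm_mult norm_divide l_def a_def b_def)
    have "norm (contour_integral L (\<lambda>w. h w * X powr w)) \<le>
        norm (h b * X powr b / l) + norm (h a * X powr a / l) + norm (contour_integral L (\<lambda>w. deriv h w * X powr w / l))"
      unfolding Leq
      by (intro order_trans[OF norm_triangle_ineq4] add_mono norm_triangle_ineq4 order_refl)
    also have "\<dots> \<le> (norm (h a) + norm (h b) + M * (2 * R)) / ln (real N)"
      using 1 2 by (simp add: add_divide_distrib)
    finally have bL: "norm (contour_integral L (\<lambda>w. h w * X powr w)) \<le> \<dots>" .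
    \<comment> \<open>The denominator \<open>w\<close> in \<open>h\<close> cancels against the
      derivative of the parametrisation, which leaves the factor \<open>\<i>\<close>.\<close>
    have "contour_integral C (\<lambda>w. h w * X powr w) =
        integral {-(pi/2)..pi/2} (\<lambda>t. \<i> * (G (R * cis t) *
           (of_nat N powr (R * cis t) * (1 + (R * cis t)\<^sup>2 / of_real (R\<^sup>2)))))"
      unfolding C_def
    proof (subst contour_integral_part_circlepath_eq)
      show "integral {- (pi / 2)..pi / 2} (\<lambda>t. h (0 + R * cis t) * X powr (0 + R * cis t) * R * \<i> * cis t) =
        integral {-(pi/2)..pi/2} (\<lambda>t. \<i> * (G (R * cis t) *
           (of_nat N powr (R * cis t) * (1 + (R * cis t)\<^sup>2 / of_real (R\<^sup>2)))))"
        using \<open>R > 0\<close> by (intro integral_cong) (simp add: h_def G X_def)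
    qed (use pi_gt_zero in linarith)
    also have "\<dots> = \<i> * ?I N" by simp
    finally show ?thesis using bL CL by (simp add: norm_mult)
  qed
  have "(\<lambda>N. (norm (h a) + norm (h b) + M * (2 * R)) / ln (real N)) \<longlonglongrightarrow> 0"
    by real_asymp
  then show ?thesis
    by (rule Lim_null_comparison[rotated]) (use bound in \<open>auto intro!: eventually_at_top_linorderI[of 2]\<close>)
qed

text \<open>The estimate for the right half circle: multiplied by the kernel, the right-hand side
  becomes the constant \<open>2 * B / R\<close>.\<close>

lemma norm_Dirichlet_tail_le:
  fixes b :: "nat \<Rightarrow> complex"
  assumes b: "\<And>n. norm (b n) \<le> B" and w: "Re w > 0" and "N > 0"
    and G: "(\<lambda>n. b n * of_nat n powr (-w - 1)) sums g"
  shows "norm (g - (\<Sum>n\<le>N. b n * of_nat n powr (-w - 1))) \<le> B * (real N powr (- Re w) / Re w)"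
proof -
  let ?t = "\<lambda>n. b (n + Suc N) * of_nat (n + Suc N) powr (-w - 1)"
  have "B \<ge> 0" using b[of 0] norm_ge_zero order_trans by blast
  have le: "norm (?t n) \<le> B * real (n + Suc N) powr (- Re w - 1)" for n
    unfolding norm_mult norm_nat_powr using b by (intro mult_mono) (use \<open>B \<ge> 0\<close> in auto)
  note T = suminf_nat_powr_tail_le[OF w \<open>N > 0\<close>]
  have "?t sums (g - (\<Sum>n<Suc N. b n * of_nat n powr (-w - 1)))"
    using G by (rule sums_split_initial_segment)
  then have "?t sums (g - (\<Sum>n\<le>N. b n * of_nat n powr (-w - 1)))"
    by (simp only: lessThan_Suc_atMost)
  then have "norm (g - (\<Sum>n\<le>N. b n * of_nat n powr (-w - 1))) = norm (\<Sum>n. ?t n)"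
    by (simp add: sums_iff)
  also have "\<dots> \<le> (\<Sum>n. B * real (n + Suc N) powr (- Re w - 1))"
    by (rule norm_suminf_le[OF le summable_mult[OF T(1)]])
  also have "\<dots> = B * (\<Sum>n. real (n + Suc N) powr (- Re w - 1))"
    by (rule suminf_mult[OF T(1)])
  also have "\<dots> \<le> B * (real N powr (- Re w) / Re w)"
    by (rule mult_left_mono[OF T(2) \<open>B \<ge> 0\<close>])
  finally show ?thesis .
qed

text \<open>The estimate for the left half circle, where the series may diverge but its partial
  sums, being entire, can be bounded directly. The extra \<open>1 / N\<close> comes from the last
  term of an increasing sum and disappears in the limit.\<close>

lemma norm_Dirichlet_partial_sum_le:
  fixes b :: "nat \<Rightarrow> complex"
  assumes b: "\<And>n. norm (b n) \<le> B" and w: "Re w < 0" and "N > 0"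
  shows "norm (\<Sum>n\<le>N. b n * of_nat n powr (-w - 1)) \<le> B * (real N powr (- Re w) * (1 / \<bar>Re w\<bar> + 1 / real N))"
proof -
  have "B \<ge> 0" using b[of 0] norm_ge_zero order_trans by blast
  have "norm (\<Sum>n\<le>N. b n * of_nat n powr (-w - 1)) = norm (\<Sum>n\<in>{1..N}. b n * of_nat n powr (-w - 1))"
    by (rule arg_cong[where f = norm], rule sum.mono_neutral_right) (auto simp: not_le)
  also have "\<dots> \<le> (\<Sum>n\<in>{1..N}. B * real n powr (- Re w - 1))"
    by (rule sum_norm_le) (auto simp: norm_mult norm_nat_powr intro!: mult_right_mono b)
  also have "\<dots> = B * (\<Sum>n\<in>{1..N}. real n powr (- Re w - 1))"
    by (simp add: sum_distrib_left)
  also have "\<dots> \<le> B * (real N powr (- Re w) / (- Re w) + real N powr (- Re w - 1))"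
    using w \<open>N > 0\<close> \<open>B \<ge> 0\<close> by (intro mult_left_mono sum_nat_powr_le) auto
  also have "real N powr (- Re w - 1) = real N powr (- Re w) / real N"
    using \<open>N > 0\<close> by (simp add: powr_diff)
  finally show ?thesis using w by (simp add: algebra_simps)
qed

text \<open>The partial sum \<open>S N\<close> is entire and the weight \<open>Q\<close> has
  \<open>Q 0 = 1\<close>, so the mean value over the circle recovers \<open>S N 0\<close>. All
  contributions tend to \<open>0\<close> with \<open>N\<close> except a constant
  \<open>2 * B / R\<close>, and \<open>R\<close> is arbitrary.\<close>

lemma Newman_partial_sums_tendsto_0:
  fixes b :: "nat \<Rightarrow> complex"
  assumes b: "\<And>n. norm (b n) \<le> B"
    and U: "open U" "{w. Re w \<ge> 0} \<subseteq> U" and G: "G holomorphic_on U" "G 0 = 0"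
    and sums: "\<And>w. Re w > 0 \<Longrightarrow> (\<lambda>n. b n * of_nat n powr (-w - 1)) sums G w"
  shows "(\<lambda>N. \<Sum>n\<le>N. b n * of_nat n powr (-1)) \<longlonglongrightarrow> 0"
proof (rule LIMSEQ_I)
  fix e :: real assume e: "e > 0"
  define S where "S = (\<lambda>N w. \<Sum>n\<le>N. b n * of_nat n powr (-w - 1))"
  have "B \<ge> 0" using b[of 0] norm_ge_zero order_trans by blast
  \<comment> \<open>Makes \<open>2 * B / R\<close> smaller than \<open>e\<close>; the summand
    \<open>1\<close> keeps \<open>R\<close> positive when \<open>B = 0\<close>.\<close>
  define R where "R = 8 * B / e + 1"
  have "R > 0" using \<open>B \<ge> 0\<close> e by (auto simp: R_def intro: add_nonneg_pos)
  define I where "I = (\<lambda>N. integral {-(pi/2)..pi/2} (\<lambda>t. G (R * cis t) *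
           (of_nat N powr (R * cis t) * (1 + (R * cis t)\<^sup>2 / of_real (R\<^sup>2)))))"
  have I: "I \<longlonglongrightarrow> 0"
    unfolding I_def by (rule half_circle_Newman_integral_tendsto_0[OF U G \<open>R > 0\<close>])
  have bound: "2 * pi * norm (S N 0) \<le> norm (I N) + 2 * B / R * pi + (2 * B / R + 2 * B / real N) * pi"
    if N: "N > 0" for N
  proof -
    define Q where "Q = (\<lambda>w::complex. of_nat N powr w * (1 + w\<^sup>2 / of_real (R\<^sup>2)))"
    have normQ: "norm (Q (R * cis t)) = real N powr (R * cos t) * (2 * \<bar>cos t\<bar>)" for t
    proof -
      have "norm (1 + (R * cis t)\<^sup>2 / of_real (R\<^sup>2)) = 2 * \<bar>Re (R * cis t)\<bar> / R"
        using \<open>R > 0\<close> by (intro norm_Newman_kernel) (auto simp: norm_mult)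
      then show ?thesis
        using \<open>R > 0\<close> by (simp add: Q_def norm_mult norm_nat_powr abs_mult)
    qed
    have Shol: "S N holomorphic_on A" for A
      unfolding S_def by (intro holomorphic_intros)
    have Qhol: "Q holomorphic_on A" for A
      unfolding Q_def using N \<open>R > 0\<close> by (intro holomorphic_intros) auto
    have Scont: "continuous_on A (\<lambda>t. S N (R * cis t))" for A
      by (rule continuous_on_compose2[OF holomorphic_on_imp_continuous_on[OF Shol[of UNIV]]])
         (auto intro!: continuous_intros)
    have Qcont: "continuous_on A (\<lambda>t. Q (R * cis t))" for A
      by (rule continuous_on_compose2[OF holomorphic_on_imp_continuous_on[OF Qhol[of UNIV]]])
         (auto intro!: continuous_intros)
    have Gcont: "continuous_on {-(pi/2)..pi/2} (\<lambda>t. G (R * cis t))"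
    proof (rule continuous_on_compose2[OF holomorphic_on_imp_continuous_on[OF G(1)]])
      have "R * cis t \<in> {w. Re w \<ge> 0}" if "t \<in> {-(pi/2)..pi/2}" for t
        using that \<open>R > 0\<close> by (auto intro!: mult_nonneg_nonneg cos_ge_zero)
      then show "(\<lambda>t. R * cis t) ` {-(pi/2)..pi/2} \<subseteq> U" using U(2) by blast
    qed (auto intro!: continuous_intros)
    let ?SQ = "\<lambda>t. S N (R * cis t) * Q (R * cis t)"
    let ?GQ = "\<lambda>t. G (R * cis t) * Q (R * cis t)"
    have "((\<lambda>t. S N (R * cis t) * Q (R * cis t)) has_integral 2 * of_real pi * (S N 0 * Q 0)) {-(pi/2)..3*pi/2}"
      using Shol Qhol \<open>R > 0\<close> by (intro circle_mean_value[of "\<lambda>w. S N w * Q w"] holomorphic_intros) auto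
    then have "2 * of_real pi * S N 0 = integral {-(pi/2)..3*pi/2} ?SQ"
      using N by (simp add: Q_def has_integral_iff)
    also have "\<dots> = integral {-(pi/2)..pi/2} ?SQ + integral {pi/2..3*pi/2} ?SQ"
      by (rule Henstock_Kurzweil_Integration.integral_combine[symmetric])
         (use pi_gt_zero in \<open>auto intro!: integrable_continuous_real continuous_intros Scont Qcont\<close>)
    \<comment> \<open>On the right half circle the partial sum is the limit function minus the tail.
      The limit function gives \<open>I N\<close>, which tends to \<open>0\<close>, and the tail is
      matched by the kernel.\<close>
    also have "integral {-(pi/2)..pi/2} ?SQ = integral {-(pi/2)..pi/2} (\<lambda>t. ?GQ t - (?GQ t - ?SQ t))"
      by simp
    also have "\<dots> = integral {-(pi/2)..pi/2} ?GQ - integral {-(pi/2)..pi/2} (\<lambda>t. ?GQ t - ?SQ t)"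
      by (rule integral_diff; intro integrable_continuous_real continuous_intros Scont Qcont Gcont)
    finally have eq: "2 * of_real pi * S N 0 = I N - integral {-(pi/2)..pi/2} (\<lambda>t. ?GQ t - ?SQ t) + integral {pi/2..3*pi/2} ?SQ"
      by (simp add: I_def Q_def)
    have "norm (integral {-(pi/2)..pi/2} (\<lambda>t. ?GQ t - ?SQ t)) \<le> 2 * B / R * (pi/2 - (-(pi/2)))"
    proof (rule integral_bound)
      show "norm (?GQ t - ?SQ t) \<le> 2 * B / R" if t: "t \<in> {-(pi/2)..pi/2}" for t
      \<comment> \<open>At the two points on the imaginary axis the series is not known to converge,
        but the kernel is \<open>0\<close> there.\<close>
      proof (cases "cos t = 0")
        case False
        then have c: "cos t > 0" using t cos_ge_zero[of t] by auto
        define d where "d = real N powr (R * cos t)"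
        have d: "d > 0" using N by (simp add: d_def)
        have "norm (?GQ t - ?SQ t) = norm (G (R * cis t) - S N (R * cis t)) * norm (Q (R * cis t))"
          by (simp add: left_diff_distrib flip: norm_mult)
        also have "\<dots> \<le> B * (real N powr (- Re (R * cis t)) / Re (R * cis t)) * norm (Q (R * cis t))"
          unfolding S_def using c \<open>R > 0\<close> N
          by (intro mult_right_mono norm_Dirichlet_tail_le b sums) auto
        also have "\<dots> = B * (1 / d / (R * cos t)) * (d * (2 * cos t))"
          using c by (simp add: normQ powr_minus_divide d_def)
        also have "\<dots> = 2 * B / R" using c d by simp
        finally show ?thesis .
      qed (use \<open>B \<ge> 0\<close> \<open>R > 0\<close> in \<open>simp add: normQ norm_mult flip: left_diff_distrib\<close>)
    qed (auto intro!: continuous_intros Scont Qcont Gcont)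
    then have 1: "norm (integral {-(pi/2)..pi/2} (\<lambda>t. ?GQ t - ?SQ t)) \<le> 2 * B / R * pi"
      by simp
    have "norm (integral {pi/2..3*pi/2} ?SQ) \<le> (2 * B / R + 2 * B / real N) * (3*pi/2 - pi/2)"
    proof (rule integral_bound)
      show "norm (?SQ t) \<le> 2 * B / R + 2 * B / real N" if t: "t \<in> {pi/2..3*pi/2}" for t
      proof (cases "cos t = 0")
        case False
        have "cos t = - cos (t - pi)" by simp
        moreover have "cos (t - pi) \<ge> 0" using t by (intro cos_ge_zero) auto
        ultimately have c: "cos t < 0" using False by linarith
        define d where "d = real N powr (R * cos t)"
        have d: "d > 0" using N by (simp add: d_def)
        have "norm (?SQ t) \<le> B * (real N powr (- Re (R * cis t)) * (1 / \<bar>Re (R * cis t)\<bar> + 1 / real N)) * norm (Q (R * cis t))"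
          unfolding S_def norm_mult[of _ "Q _"] using c \<open>R > 0\<close> N
          by (intro mult_right_mono norm_Dirichlet_partial_sum_le b) (auto simp: mult_pos_neg)
        also have "\<dots> = B * (1 / d * (1 / (R * \<bar>cos t\<bar>) + 1 / real N)) * (d * (2 * \<bar>cos t\<bar>))"
          using \<open>R > 0\<close> by (simp add: normQ powr_minus_divide d_def abs_mult)
        also have "\<dots> = 2 * B / R + 2 * B / real N * \<bar>cos t\<bar>" using c d N \<open>R > 0\<close> by (simp add: field_simps)
        also have "\<dots> \<le> 2 * B / R + 2 * B / real N * 1" using \<open>B \<ge> 0\<close>
          by (intro add_left_mono mult_left_mono) auto
        finally show ?thesis by simp
      qed (use \<open>B \<ge> 0\<close> \<open>R > 0\<close> in \<open>simp add: normQ norm_mult\<close>)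
    qed (use pi_gt_zero in \<open>auto intro!: continuous_intros Scont Qcont\<close>)
    then have 2: "norm (integral {pi/2..3*pi/2} ?SQ) \<le> (2 * B / R + 2 * B / real N) * pi"
      by (simp add: field_simps)
    have "2 * pi * norm (S N 0) = norm (2 * of_real pi * S N 0)"
      by (simp add: norm_mult)
    also have "\<dots> \<le> norm (I N) + norm (integral {-(pi/2)..pi/2} (\<lambda>t. ?GQ t - ?SQ t)) + norm (integral {pi/2..3*pi/2} ?SQ)"
      unfolding eq
      by (intro order_trans[OF norm_triangle_ineq] add_mono norm_triangle_ineq4 order_refl)
    finally show ?thesis using 1 2 by linarith
  qed
  have "(\<lambda>N. norm (I N) / (2 * pi) + 2 * B / R + B / real N) \<longlonglongrightarrow> 0 / (2 * pi) + 2 * B / R + 0"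
    using tendsto_norm[OF I] by (intro tendsto_intros lim_const_over_n) auto
  moreover have "0 / (2 * pi) + 2 * B / R + 0 < e"
    using e \<open>B \<ge> 0\<close> \<open>R > 0\<close> by (simp add: R_def field_simps add_pos_nonneg)
  ultimately have "\<forall>\<^sub>F N in sequentially. norm (I N) / (2 * pi) + 2 * B / R + B / real N < e"
    by (rule order_tendstoD)
  then have "\<forall>\<^sub>F N in sequentially. norm (S N 0) < e"
    using eventually_gt_at_top[of 0]
  proof eventually_elim
    case (elim N)
    have "norm (S N 0) \<le> norm (I N) / (2 * pi) + 2 * B / R + B / real N"
      using bound[of N] elim by (simp add: field_simps)
    with elim show ?case by linarith
  qed
  then show "\<exists>no. \<forall>N\<ge>no. norm ((\<Sum>n\<le>N. b n * of_nat n powr (-1)) - 0) < e"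
    by (simp add: eventually_at_top_linorder S_def)
qed

text \<open>Changing the coefficient at \<open>n = 1\<close> by \<open>F 1\<close> changes the
  Dirichlet series by the constant \<open>F 1\<close>, which arranges the value \<open>0\<close> at
  the critical point. The substitution \<open>s = w + 1\<close> moves that point to
  \<open>0\<close>.\<close>

theorem Newman_Tauberian:
  fixes b :: "nat \<Rightarrow> complex"
  assumes b: "\<And>n. norm (b n) \<le> B"
    and U: "open U" "{s. Re s \<ge> 1} \<subseteq> U" and F: "F holomorphic_on U"
    and sums: "\<And>s. Re s > 1 \<Longrightarrow> (\<lambda>n. b n * of_nat n powr (-s)) sums F s"
  shows "(\<lambda>n. b n / of_nat n) sums F 1"
proof -
  define c where "c = (\<lambda>n. b n - (if n = 1 then F 1 else 0))"
  have "(\<lambda>N. \<Sum>n\<le>N. c n * of_nat n powr (-1)) \<longlonglongrightarrow> 0"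
  proof (rule Newman_partial_sums_tendsto_0)
    show "norm (c n) \<le> B + norm (F 1)" for n
      using b[of n] norm_triangle_ineq4[of "b n" "F 1"] by (auto simp: c_def intro: order_trans[OF b])
    show "open ((\<lambda>w. w + 1) -` U)"
      using U by (intro open_vimage continuous_intros)
    show "{w. 0 \<le> Re w} \<subseteq> (\<lambda>w. w + 1) -` U"
    proof
      fix w :: complex assume "w \<in> {w. 0 \<le> Re w}"
      then have "w + 1 \<in> {s. Re s \<ge> 1}" by simp
      then show "w \<in> (\<lambda>w. w + 1) -` U" using U(2) by blast
    qed
    show "(\<lambda>w. F (w + 1) - F 1) holomorphic_on (\<lambda>w. w + 1) -` U"
      by (intro holomorphic_intros holomorphic_on_compose_gen[OF _ F, unfolded o_def]) auto
    show "(\<lambda>n. c n * of_nat n powr (- w - 1)) sums (F (w + 1) - F 1)" if "Re w > 0" for w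
    proof -
      have "(\<lambda>n. (if n = 1 then F 1 else 0)) sums F 1"
        by (rule sums_single)
      then have "(\<lambda>n. b n * of_nat n powr (- (w + 1)) - (if n = 1 then F 1 else 0)) sums (F (w + 1) - F 1)"
        using sums[of "w + 1"] that by (intro sums_diff) auto
      also have "(\<lambda>n. b n * of_nat n powr (- (w + 1)) - (if n = 1 then F 1 else 0)) = (\<lambda>n. c n * of_nat n powr (- w - 1))"
        by (auto simp: c_def fun_eq_iff left_diff_distrib)
      finally show ?thesis .
    qed
  qed simp
  then have "(\<lambda>n. c n * of_nat n powr (-1)) sums 0"
    by (simp add: sums_def_le)
  also have "(\<lambda>n. c n * of_nat n powr (-1)) = (\<lambda>n. b n / of_nat n - (if n = 1 then F 1 else 0))"
    by (auto simp: c_def fun_eq_iff powr_minus_divide)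
  finally have "(\<lambda>n. b n / of_nat n - (if n = 1 then F 1 else 0)) sums 0" .
  moreover have "(\<lambda>n. (if n = 1 then F 1 else 0)) sums F 1"
    by (rule sums_single)
  ultimately have "(\<lambda>n. b n / of_nat n - (if n = 1 then F 1 else 0) + (if n = 1 then F 1 else 0)) sums
      (0 + F 1)"
    by (rule sums_add)
  then show ?thesis by simp
qed

subsection \<open>Dirichlet series on the half-plane of absolute convergence\<close>

lemma norm_real_powr_diff_le:
  fixes v :: complex and a x y :: real
  assumes "a > 0" "Re v \<ge> -1" "x \<ge> a" "y \<ge> a"
  shows "norm (of_real x powr (-v) - of_real y powr (-v)) \<le> norm v * a powr (- Re v - 1) * \<bar>x - y\<bar>"
proof -
  define S where "S = complex_of_real ` {a..}"
  have "norm (of_real x powr (-v) - of_real y powr (-v)) \<le> norm v * a powr (- Re v - 1) * norm (complex_of_real x - of_real y)"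
  proof (rule field_differentiable_bound[of S])
    show "convex S"
      unfolding S_def by (rule convex_linear_image) (auto simp: bounded_linear.linear bounded_linear_of_real)
    fix z assume "z \<in> S"
    then obtain t where t: "z = of_real t" "t \<ge> a" by (auto simp: S_def)
    show "((\<lambda>z. z powr (-v)) has_field_derivative (-v) * z powr (-v - 1)) (at z within S)"
      using t assms by (intro has_field_derivative_at_within[OF has_field_derivative_powr]) auto
    have "norm (z powr (-v - 1)) = t powr (- Re v - 1)"
      using t assms by (simp add: norm_powr_real_powr)
    also have "\<dots> \<le> a powr (- Re v - 1)"
      using t assms by (intro powr_mono2') auto
    finally show "norm (- v * z powr (- v - 1)) \<le> norm v * a powr (- Re v - 1)"
      by (simp add: norm_mult mult_left_mono)
  qed (use assms in \<open>auto simp: S_def\<close>)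
  also have "norm (complex_of_real x - of_real y) = \<bar>x - y\<bar>"
    by (metis norm_of_real of_real_diff)
  finally show ?thesis .
qed

text \<open>The error of the first-order approximation
  \<open>n^(-w) - (n+1)^(-w) ~ w * n^(-w-1)\<close>. It is one order smaller than the main term, so
  series built from it converge one unit further to the left. This provides both the continuation of
  zeta and the holomorphic remainder in the summation by parts.\<close>

definition powr_defect :: "nat \<Rightarrow> complex \<Rightarrow> complex" where
  "powr_defect n w = of_nat n powr (-w) - of_nat (Suc n) powr (-w) - w * of_nat n powr (-w - 1)"

text \<open>Two applications of the mean value inequality. The linear term in \<open>k\<close> turns
  the defect into \<open>k a - k (a + 1)\<close>, and the derivative of \<open>k\<close> is again a
  difference of powers, now with exponent \<open>-(w + 1)\<close>.\<close>

lemma norm_powr_defect_le: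
  assumes n: "n > 0" and w: "Re w > -1"
  shows "norm (powr_defect n w) \<le> norm w * norm (w + 1) * real n powr (- Re w - 2)"
proof -
  define a where "a = real n"
  have a: "a > 0" "a \<ge> 1" using n by (auto simp: a_def)
  define S where "S = complex_of_real ` {a..a+1}"
  have S: "of_real a \<in> S" "of_real (a + 1) \<in> S"
    unfolding S_def by (rule imageI, simp)+
  define k where "k = (\<lambda>z. z powr (-w) + w * of_real a powr (-w - 1) * z)"
  have "norm (k (of_real a) - k (of_real (a + 1))) \<le> norm w * (norm (w + 1) * a powr (- Re w - 2)) * norm (complex_of_real a - of_real (a + 1))"
  proof (rule field_differentiable_bound[of S])
    show "convex S"
      unfolding S_def by (rule convex_linear_image) (auto simp: bounded_linear.linear bounded_linear_of_real)
    fix z assume "z \<in> S"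
    then obtain t where t: "z = of_real t" "t \<ge> a" "t \<le> a + 1" by (auto simp: S_def)
    have "((\<lambda>z. z powr (-w)) has_field_derivative (-w) * z powr (-w - 1)) (at z within S)"
      using t a by (intro has_field_derivative_at_within[OF has_field_derivative_powr]) auto
    then show "(k has_field_derivative - w * (z powr (-w - 1) - of_real a powr (-w - 1))) (at z within S)"
      unfolding k_def
      by (rule DERIV_cong[OF DERIV_add[OF _ DERIV_cmult[OF DERIV_ident]]]) (simp add: algebra_simps)
    have e: "-(w + 1) = -w - 1" "- Re (w + 1) - 1 = - Re w - 2" by simp_all
    have "norm (z powr (-(w + 1)) - of_real a powr (-(w + 1))) \<le> norm (w + 1) * a powr (- Re (w + 1) - 1) * \<bar>t - a\<bar>"
      using norm_real_powr_diff_le[of a "w + 1" t a] t a w by simp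
    also have "\<dots> \<le> norm (w + 1) * a powr (- Re (w + 1) - 1) * 1"
      using t by (intro mult_left_mono) auto
    finally show "norm (- w * (z powr (-w - 1) - of_real a powr (-w - 1))) \<le> norm w * (norm (w + 1) * a powr (- Re w - 2))"
      unfolding e norm_mult norm_minus_cancel by (intro mult_left_mono) auto
  qed (fact S)+
  also have "k (of_real a) - k (of_real (a + 1)) = powr_defect n w"
  proof -
    have "complex_of_real a = of_nat n" "complex_of_real (a + 1) = of_nat (Suc n)"
      by (simp_all add: a_def)
    then show ?thesis
      unfolding k_def powr_defect_def by (simp only:) (simp add: ring_distribs)
  qed
  also have "norm (complex_of_real a - of_real (a + 1)) = 1"
    by simp
  finally show ?thesis by (simp only: a_def mult.assoc mult_1_right)
qed

section \<open>Absolutely convergent Dirichlet series, their derivatives and products\<close>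

definition dirichlet_summable :: "(nat \<Rightarrow> complex) \<Rightarrow> bool" where
  "dirichlet_summable a \<longleftrightarrow> (\<forall>\<sigma>>1. summable (\<lambda>n. norm (a n) * real n powr (-\<sigma>)))"

definition dirichlet :: "(nat \<Rightarrow> complex) \<Rightarrow> complex \<Rightarrow> complex" where
  "dirichlet a s = (\<Sum>n. a n * of_nat n powr (-s))"

lemma dirichlet_summable_bounded:
  assumes "\<And>n. n > 0 \<Longrightarrow> norm (a n) \<le> C"
  shows "dirichlet_summable a"
  unfolding dirichlet_summable_def
proof safe
  fix \<sigma> :: real assume "\<sigma> > 1"
  then have "summable (\<lambda>n. C * real n powr (-\<sigma>))"
    by (intro summable_mult) (simp add: summable_real_powr_iff)
  moreover have "norm (norm (a n) * real n powr (-\<sigma>)) \<le> C * real n powr (-\<sigma>)" for n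
    using assms[of n] by (cases "n = 0") (auto intro!: mult_right_mono)
  ultimately show "summable (\<lambda>n. norm (a n) * real n powr (-\<sigma>))"
    by (rule summable_comparison_test'[where N = 0])
qed

text \<open>A logarithm costs only \<open>n powr e\<close>, and the open condition
  \<open>\<sigma> > 1\<close> leaves room for a small \<open>e\<close>.\<close>

lemma dirichlet_summable_ln:
  assumes "dirichlet_summable a"
  shows "dirichlet_summable (\<lambda>n. of_real (ln (real n)) * a n)"
  unfolding dirichlet_summable_def
proof safe
  fix \<sigma> :: real assume \<sigma>: "\<sigma> > 1"
  define e where "e = (\<sigma> - 1) / 2"
  have e: "e > 0" "\<sigma> - e > 1" using \<sigma> by (auto simp: e_def field_simps)
  have "summable (\<lambda>n. norm (a n) * real n powr (-(\<sigma> - e)))"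
    using assms e unfolding dirichlet_summable_def by blast
  then have "summable (\<lambda>n. norm (a n) * real n powr (-(\<sigma> - e)) / e)"
    by (rule summable_divide)
  moreover have "norm (norm (of_real (ln (real n)) * a n) * real n powr (-\<sigma>)) \<le> norm (a n) * real n powr (-(\<sigma> - e)) / e" for n
  proof (cases "n = 0")
    case False
    then have "ln (real n) \<le> real n powr e / e" using e by (intro ln_powr_bound) auto
    then have "norm (a n) * real n powr (-\<sigma>) * ln (real n) \<le> norm (a n) * real n powr (-\<sigma>) * (real n powr e / e)"
      by (intro mult_left_mono) auto
    also have "\<dots> = norm (a n) * real n powr (-(\<sigma> - e)) / e"
      by (simp add: algebra_simps flip: powr_add)
    finally show ?thesis using False by (simp add: norm_mult abs_mult mult_ac)
  qed simp
  ultimately show "summable (\<lambda>n. norm (of_real (ln (real n)) * a n) * real n powr (-\<sigma>))"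
    by (rule summable_comparison_test'[where N = 0])
qed

lemma dirichlet_summable_comparison:
  assumes "dirichlet_summable b" "\<And>n. n > 0 \<Longrightarrow> norm (a n) \<le> norm (b n)"
  shows "dirichlet_summable a"
  unfolding dirichlet_summable_def
proof safe
  fix \<sigma> :: real assume "\<sigma> > 1"
  then have "summable (\<lambda>n. norm (b n) * real n powr (-\<sigma>))"
    using assms by (auto simp: dirichlet_summable_def)
  moreover have "norm (norm (a n) * real n powr (-\<sigma>)) \<le> norm (b n) * real n powr (-\<sigma>)" for n
    using assms(2)[of n] by (cases "n = 0") (auto intro!: mult_right_mono)
  ultimately show "summable (\<lambda>n. norm (a n) * real n powr (-\<sigma>))"
    by (rule summable_comparison_test'[where N = 0])
qed

lemma
  assumes "dirichlet_summable a" "Re s > 1"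
  shows summable_norm_dirichlet: "summable (\<lambda>n. norm (a n * of_nat n powr (-s)))"
    and dirichlet_sums: "(\<lambda>n. a n * of_nat n powr (-s)) sums dirichlet a s"
proof -
  show *: "summable (\<lambda>n. norm (a n * of_nat n powr (-s)))"
    using assms by (simp add: norm_mult norm_nat_powr dirichlet_summable_def)
  show "(\<lambda>n. a n * of_nat n powr (-s)) sums dirichlet a s"
    unfolding dirichlet_def by (rule summable_sums[OF summable_norm_cancel[OF *]])
qed

lemma dirichlet_has_sum:
  assumes "dirichlet_summable a" "Re s > 1"
  shows "((\<lambda>n. a n * of_nat n powr (-s)) has_sum dirichlet a s) {1..}"
proof -
  have "((\<lambda>n. a n * of_nat n powr (-s)) has_sum dirichlet a s) UNIV"
    by (intro norm_summable_imp_has_sum summable_norm_dirichlet dirichlet_sums assms)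
  also have "?this \<longleftrightarrow> ?thesis"
    by (rule has_sum_cong_neutral) (auto simp: not_le)
  finally show ?thesis .
qed

lemma has_field_derivative_dirichlet:
  assumes a: "dirichlet_summable a" and s: "Re s > 1"
  shows "(dirichlet a has_field_derivative - dirichlet (\<lambda>n. of_real (ln (real n)) * a n) s) (at s)"
proof -
  define S where "S = {s. Re s > 1}"
  have "open S" unfolding S_def by (rule open_halfspace_Re_gt)
  have "\<exists>g g'. \<forall>x \<in> S. ((\<lambda>n. a n * of_nat n powr (-x)) sums g x) \<and>
      ((\<lambda>n. - (of_real (ln (real n)) * a n * of_nat n powr (-x))) sums g' x) \<and> (g has_field_derivative g' x) (at x)"
  proof (rule series_and_derivative_comparison_complex[OF \<open>open S\<close>])
    fix n x assume "x \<in> S"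
    show "((\<lambda>x. a n * of_nat n powr (-x)) has_field_derivative - (of_real (ln (real n)) * a n * of_nat n powr (-x))) (at x)"
    proof (cases "n = 0")
      case False
      have "((\<lambda>x. of_nat n powr (-x)) has_field_derivative (Ln (of_nat n) * of_nat n powr (-x)) * (-1)) (at x)"
        using False by (intro DERIV_chain2[OF has_field_derivative_powr_right]) (auto intro!: derivative_eq_intros)
      from DERIV_cmult[OF this, of "a n"] False show ?thesis
        by (simp add: Ln_of_nat mult_ac)
    qed simp
  next
    fix x assume x: "x \<in> S"
    define d where "d = (Re x - 1) / 2"
    have d: "d > 0" "Re x - d > 1" using x by (auto simp: S_def d_def field_simps)
    define h where "h = (\<lambda>n. complex_of_real (norm (a n) * real n powr (-(Re x - d))))"
    have "summable (\<lambda>n. norm (a n) * real n powr (-(Re x - d)))"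
      using a d unfolding dirichlet_summable_def by blast
    then have "summable h" unfolding h_def by (rule summable_of_real)
    moreover have "range h \<subseteq> \<real>\<^sub>\<ge>\<^sub>0" by (auto simp: h_def)
    moreover have "norm (a n * of_nat n powr (-y)) \<le> norm (h n)" if "y \<in> ball x d" for n y
    proof (cases "n = 0")
      case False
      have "\<bar>Re (x - y)\<bar> < d"
        using that abs_Re_le_cmod[of "x - y"] by (simp add: dist_norm)
      then have "real n powr (- Re y) \<le> real n powr (-(Re x - d))"
        using False by (intro powr_mono) auto
      then show ?thesis
        by (auto simp: h_def norm_mult norm_nat_powr intro!: mult_left_mono)
    qed (simp add: h_def)
    ultimately show "\<exists>d h. 0 < d \<and> summable h \<and> range h \<subseteq> \<real>\<^sub>\<ge>\<^sub>0 \<and>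
        (\<forall>\<^sub>F n in sequentially. \<forall>y\<in>ball x d \<inter> S. cmod (a n * of_nat n powr (-y)) \<le> cmod (h n))"
      using d by (intro exI[of _ d] exI[of _ h]) auto
  qed
  then obtain g g' where g: "\<And>x. x \<in> S \<Longrightarrow> (\<lambda>n. a n * of_nat n powr (-x)) sums g x"
      "\<And>x. x \<in> S \<Longrightarrow> (\<lambda>n. - (of_real (ln (real n)) * a n * of_nat n powr (-x))) sums g' x"
      "\<And>x. x \<in> S \<Longrightarrow> (g has_field_derivative g' x) (at x)" by blast
  have "s \<in> S" using s by (simp add: S_def)
  have "g' s = - dirichlet (\<lambda>n. of_real (ln (real n)) * a n) s"
    using sums_minus[OF g(2)[OF \<open>s \<in> S\<close>]] unfolding dirichlet_def
    by (simp add: sums_iff)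
  moreover have "(dirichlet a has_field_derivative g' s) (at s)"
    using g(3)[OF \<open>s \<in> S\<close>] \<open>open S\<close> \<open>s \<in> S\<close>
  proof (rule has_field_derivative_transform_within_open)
    show "g x = dirichlet a x" if "x \<in> S" for x
      using g(1)[OF that] unfolding dirichlet_def by (simp add: sums_iff)
  qed
  ultimately show ?thesis by simp
qed

text \<open>Absolute convergence allows the double sum over pairs \<open>(d, m)\<close> to be
  regrouped according to the product \<open>n = d * m\<close>.\<close>

lemma dirichlet_mult:
  assumes a: "dirichlet_summable a" and b: "dirichlet_summable b" and s: "Re s > 1"
  shows "dirichlet a s * dirichlet b s = dirichlet (\<lambda>n. \<Sum>d | d dvd n. a d * b (n div d)) s"
proof -
  define A where "A = (\<lambda>n. a n * of_nat n powr (-s))"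
  define B where "B = (\<lambda>n. b n * of_nat n powr (-s))"
  \<comment> \<open>The index \<open>0\<close> is left out because every number divides it, so the
    correspondence between pairs \<open>(d, m)\<close> and pairs of a number with one of its
    divisors would fail.\<close>
  define I where "I = {1::nat..}"
  have A: "(A has_sum dirichlet a s) I" and B: "(B has_sum dirichlet b s) I"
    unfolding A_def B_def I_def by (rule dirichlet_has_sum[OF a s] dirichlet_has_sum[OF b s])+
  have norm_sum: "(\<lambda>n. norm (f n * of_nat n powr (-s))) summable_on I" if "dirichlet_summable f" for f
    by (rule summable_on_subset_banach[OF norm_summable_imp_summable_on subset_UNIV])
       (simp add: summable_norm_dirichlet[OF that s])
  have "(\<lambda>(d, m). norm (A d) * norm (B m)) summable_on Sigma I (\<lambda>_. I)"
  proof (rule summable_on_SigmaI)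
    show "((\<lambda>m. case (d, m) of (d, m) \<Rightarrow> norm (A d) * norm (B m)) has_sum (norm (A d) * infsum (\<lambda>m. norm (B m)) I)) I" for d
      using has_sum_cmult_right[OF has_sum_infsum[OF norm_sum[OF b]], of "norm (A d)"] by (simp add: B_def)
    show "(\<lambda>d. norm (A d) * infsum (\<lambda>m. norm (B m)) I) summable_on I"
      using summable_on_cmult_left[OF norm_sum[OF a]] by (simp add: A_def)
  qed auto
  then have "(\<lambda>x. norm (case x of (d, m) \<Rightarrow> A d * B m)) summable_on I \<times> I"
    by (simp add: case_prod_unfold norm_mult)
  then have "(\<lambda>(d, m). A d * B m) summable_on I \<times> I"
    by (rule abs_summable_summable)
  then obtain T where T: "((\<lambda>(d, m). A d * B m) has_sum T) (I \<times> I)"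
    by (auto simp: summable_on_def)
  have "((\<lambda>d. A d * dirichlet b s) has_sum T) I"
    using T by (rule has_sum_SigmaD) (auto intro: has_sum_cmult_right B)
  then have T_eq: "T = dirichlet a s * dirichlet b s"
    using has_sum_cmult_left[OF A, of "dirichlet b s"] has_sum_unique by blast
  have "((\<lambda>(n, d). A d * B (n div d)) has_sum T) (Sigma I (\<lambda>n. {d. d dvd n})) \<longleftrightarrow>
        ((\<lambda>(d, m). A d * B m) has_sum T) (I \<times> I)"
    by (rule has_sum_reindex_bij_witness[of _ "\<lambda>(d, m). (d * m, d)" "\<lambda>(n, d). (d, n div d)"])
       (auto simp: I_def Suc_le_eq intro!: Nat.gr0I elim!: dvdE)
  with T have "((\<lambda>(n, d). A d * B (n div d)) has_sum T) (Sigma I (\<lambda>n. {d. d dvd n}))"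
    by simp
  then have "((\<lambda>n. \<Sum>d | d dvd n. A d * B (n div d)) has_sum T) I"
    by (rule has_sum_SigmaD) (auto simp: I_def intro!: has_sum_finiteI)
  also have "?this \<longleftrightarrow> ((\<lambda>n. (\<Sum>d | d dvd n. a d * b (n div d)) * of_nat n powr (-s)) has_sum T) UNIV"
  proof (rule has_sum_cong_neutral)
    fix n assume "n \<in> I \<inter> UNIV"
    then have n: "n > 0" by (auto simp: I_def)
    show "(\<Sum>d | d dvd n. A d * B (n div d)) = (\<Sum>d | d dvd n. a d * b (n div d)) * of_nat n powr (-s)"
      unfolding sum_distrib_right
    proof (rule sum.cong)
      fix d assume "d \<in> {d. d dvd n}"
      then obtain m where m: "n = d * m" by auto
      have "(of_nat n :: complex) powr (-s) = of_nat d powr (-s) * of_nat m powr (-s)"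
        unfolding m by (simp add: powr_times_real)
      then show "A d * B (n div d) = a d * b (n div d) * of_nat n powr (-s)"
        using n m by (simp add: A_def B_def)
    qed simp
  qed (auto simp: I_def not_le)
  finally have "(\<lambda>n. (\<Sum>d | d dvd n. a d * b (n div d)) * of_nat n powr (-s)) sums T"
    by (rule has_sum_imp_sums)
  then show ?thesis
    unfolding T_eq dirichlet_def by (simp add: sums_iff)
qed

subsection \<open>The zeta function and its nonvanishing\<close>

text \<open>The bound separates a factor that is locally bounded in \<open>s\<close> from a power of
  \<open>n\<close> that is summable uniformly on small balls. The series for
  \<open>(s - 1) * zeta s\<close> and the remainder of the Chebyshev error both satisfy a bound of
  this shape.\<close>

lemma
  fixes f :: "nat \<Rightarrow> complex \<Rightarrow> complex"
  assumes hol: "\<And>n. f n holomorphic_on {s. Re s > 0}" and "B \<ge> 0"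
    and bound: "\<And>n s. n > 0 \<Longrightarrow> Re s > 0 \<Longrightarrow> norm (f n s) \<le> B * (norm s + 1)\<^sup>2 * real n powr (- Re s - 1)"
  shows holomorphic_suminf_half_plane: "(\<lambda>s. \<Sum>n. f n s) holomorphic_on {s. Re s > 0}"
    and sums_suminf_half_plane: "Re s > 0 \<Longrightarrow> (\<lambda>n. f n s) sums (\<Sum>n. f n s)"
proof -
  define S where "S = {s. Re s > 0}"
  have "open S" unfolding S_def by (rule open_halfspace_Re_gt)
  have dom: "\<exists>d (h :: nat \<Rightarrow> complex). 0 < d \<and> summable h \<and> range h \<subseteq> \<real>\<^sub>\<ge>\<^sub>0 \<and>
      (\<forall>\<^sub>F n in sequentially. \<forall>y\<in>ball x d \<inter> S. norm (f n y) \<le> norm (h n))" if x: "x \<in> S" for x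
  proof -
    define d where "d = Re x / 2"
    have d: "d > 0" "Re x = 2 * d" using x by (auto simp: S_def d_def)
    define K where "K = B * (norm x + d + 1)\<^sup>2"
    define h where "h = (\<lambda>n. complex_of_real (K * real n powr (-d - 1)))"
    have "summable (\<lambda>n. K * real n powr (-d - 1))"
      using d by (intro summable_mult) (simp add: summable_real_powr_iff)
    then have "summable h" unfolding h_def by (rule summable_of_real)
    moreover have "range h \<subseteq> \<real>\<^sub>\<ge>\<^sub>0" 
      using \<open>B \<ge> 0\<close> by (intro image_subsetI) (simp only: h_def nonneg_Reals_of_real_iff, simp add: K_def)
    moreover have le: "norm (f n y) \<le> norm (h n)" if n: "n > 0" and y: "y \<in> ball x d \<inter> S" for n y
    proof -
      have "\<bar>Re (x - y)\<bar> < d"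
        using y abs_Re_le_cmod[of "x - y"] by (simp add: dist_norm)
      then have Re_y: "Re y > d" using d by simp
      have norm_y: "norm y \<le> norm x + d"
        using y norm_triangle_sub[of y x] by (simp add: dist_norm norm_minus_commute)
      have "norm (f n y) \<le> B * (norm y + 1)\<^sup>2 * real n powr (- Re y - 1)"
        using y n by (intro bound) (auto simp: S_def)
      also have "\<dots> \<le> K * real n powr (- d - 1)"
        unfolding K_def using n Re_y norm_y \<open>B \<ge> 0\<close>
        by (intro mult_mono powr_mono power_mono mult_nonneg_nonneg) auto
      also have "\<dots> = norm (h n)"
        using \<open>B \<ge> 0\<close> by (simp only: h_def norm_of_real) (simp add: K_def)
      finally show ?thesis .
    qed
    moreover have "\<forall>\<^sub>F n in sequentially. \<forall>y\<in>ball x d \<inter> S. norm (f n y) \<le> norm (h n)"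
      using eventually_gt_at_top[of 0] by eventually_elim (use le in blast)
    ultimately show ?thesis
      using d(1) by (intro exI[of _ d] exI[of _ h] conjI)
  qed
  have diff: "f n field_differentiable at x" if "x \<in> S" for n x
    using hol[of n] \<open>open S\<close> that unfolding S_def by (rule holomorphic_on_imp_differentiable_at)
  obtain g where "\<forall>x\<in>S. ((\<lambda>n. f n x) sums g x) \<and> g field_differentiable at x"
    by (rule series_differentiable_comparison_complex[OF \<open>open S\<close> diff dom])
  then have g: "\<And>x. x \<in> S \<Longrightarrow> (\<lambda>n. f n x) sums g x" "\<And>x. x \<in> S \<Longrightarrow> g field_differentiable at x"
    by blast+
  have "g holomorphic_on S"
    using g(2) by (auto simp: holomorphic_on_def intro: field_differentiable_at_within)
  also have "g holomorphic_on S \<longleftrightarrow> (\<lambda>s. \<Sum>n. f n s) holomorphic_on S"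
    using g(1) by (intro holomorphic_cong) (auto simp: sums_iff)
  finally show "(\<lambda>s. \<Sum>n. f n s) holomorphic_on {s. Re s > 0}" by (simp add: S_def)
  show "(\<lambda>n. f n s) sums (\<Sum>n. f n s)" if "Re s > 0"
    using g(1)[of s] that by (auto simp: sums_iff S_def)
qed

lemma powr_defect_holomorphic [holomorphic_intros]:
  "g holomorphic_on A \<Longrightarrow> (\<lambda>s. powr_defect n (g s)) holomorphic_on A"
  unfolding powr_defect_def
  by (intro holomorphic_on_diff holomorphic_on_mult holomorphic_on_powr_right holomorphic_on_minus holomorphic_on_const)

text \<open>This is \<open>(s - 1) * zeta s\<close>, continued to \<open>Re s > 0\<close>. The sum includes \<open>n = 0\<close>: as \<open>0 powr z = 0\<close>
  for all \<open>z\<close>, the differences in the defect then telescope to \<open>0\<close>.\<close>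
definition zeta_numerator :: "complex \<Rightarrow> complex" where
  "zeta_numerator s = (\<Sum>n. - powr_defect n (s - 1))"

text \<open>The defect is taken at \<open>s - 1\<close>, so its requirement \<open>Re w > -1\<close>
  becomes \<open>Re s > 0\<close>.\<close>

lemma
  shows holomorphic_zeta_numerator: "zeta_numerator holomorphic_on {s. Re s > 0}"
    and zeta_numerator_sums: "Re s > 0 \<Longrightarrow> (\<lambda>n. - powr_defect n (s - 1)) sums zeta_numerator s"
proof -
  have hol: "(\<lambda>s. - powr_defect n (s - 1)) holomorphic_on {s. Re s > 0}" for n
    by (intro holomorphic_intros)
  have bound: "norm (- powr_defect n (s - 1)) \<le> 1 * (norm s + 1)\<^sup>2 * real n powr (- Re s - 1)"
    if "n > 0" "Re s > 0" for n s
  proof -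
    have "norm (- powr_defect n (s - 1)) \<le> norm (s - 1) * norm s * real n powr (- Re s - 1)"
    proof -
      have e: "- Re (s - 1) - 2 = - Re s - 1" by simp
      show ?thesis using norm_powr_defect_le[of n "s - 1"] that unfolding e by simp
    qed
    also have "\<dots> \<le> (norm s + 1) * (norm s + 1) * real n powr (- Re s - 1)"
      using norm_triangle_ineq4[of s 1] by (intro mult_right_mono mult_mono) auto
    finally show ?thesis by (simp add: power2_eq_square)
  qed
  show "zeta_numerator holomorphic_on {s. Re s > 0}"
    unfolding zeta_numerator_def by (rule holomorphic_suminf_half_plane[OF hol _ bound]) auto
  show "(\<lambda>n. - powr_defect n (s - 1)) sums zeta_numerator s" if "Re s > 0"
    unfolding zeta_numerator_def by (rule sums_suminf_half_plane[OF hol _ bound]) (use that in auto)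
qed

abbreviation zeta :: "complex \<Rightarrow> complex" where
  "zeta \<equiv> dirichlet (\<lambda>_. 1)"

lemma dirichlet_summable_1: "dirichlet_summable (\<lambda>_. 1)"
  by (rule dirichlet_summable_bounded[of _ 1]) simp

lemma tendsto_powr_neg_complex:
  assumes "Re w > 0"
  shows "(\<lambda>n. of_nat n powr (-w) :: complex) \<longlonglongrightarrow> 0"
proof (rule tendsto_norm_zero_cancel)
  have "(\<lambda>n. real n powr (- Re w)) \<longlonglongrightarrow> 0"
    using assms by (intro tendsto_neg_powr filterlim_real_sequentially) auto
  then show "(\<lambda>n. norm (of_nat n powr (-w) :: complex)) \<longlonglongrightarrow> 0"
    by (simp add: norm_nat_powr)
qed

lemma zeta_numerator_eq:
  assumes s: "Re s > 1"
  shows "zeta_numerator s = (s - 1) * zeta s"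
proof -
  have "(\<lambda>n. of_nat n powr (-(s - 1)) :: complex) \<longlonglongrightarrow> 0"
    using s by (intro tendsto_powr_neg_complex) auto
  from telescope_sums'[OF this]
  have "(\<lambda>n. of_nat n powr (-(s - 1)) - of_nat (Suc n) powr (-(s - 1)) :: complex) sums 0"
    by simp
  moreover have "(\<lambda>n. (s - 1) * (1 * of_nat n powr (-s))) sums ((s - 1) * zeta s)"
    using s by (intro sums_mult dirichlet_sums dirichlet_summable_1)
  ultimately have "(\<lambda>n. (s - 1) * (1 * of_nat n powr (-s)) - (of_nat n powr (-(s - 1)) - of_nat (Suc n) powr (-(s - 1)))) sums ((s - 1) * zeta s - 0)"
    by (intro sums_diff)
  also have "(\<lambda>n. (s - 1) * (1 * of_nat n powr (-s)) - (of_nat n powr (-(s - 1)) - of_nat (Suc n) powr (-(s - 1)))) =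
      (\<lambda>n. - powr_defect n (s - 1))"
  proof
    fix n
    have e: "- (s - 1) - 1 = - s" by simp
    show "(s - 1) * (1 * of_nat n powr (-s)) - (of_nat n powr (-(s - 1)) - of_nat (Suc n) powr (-(s - 1))) = - powr_defect n (s - 1)"
      unfolding powr_defect_def e by simp
  qed
  finally have "(\<lambda>n. - powr_defect n (s - 1)) sums ((s - 1) * zeta s)" by simp
  with zeta_numerator_sums[of s] s show ?thesis
    by (auto intro: sums_unique2)
qed

text \<open>The residue of zeta at \<open>1\<close>. All terms with \<open>n > 0\<close> vanish, and
  the value comes from \<open>n = 0\<close>, where \<open>0 powr 0 = 0\<close> but
  \<open>1 powr 0 = 1\<close>.\<close>

lemma zeta_numerator_1: "zeta_numerator 1 = 1"
proof -
  have "(\<lambda>n. - powr_defect n 0) sums (\<Sum>n\<in>{0}. - powr_defect n 0)"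
    by (rule sums_finite) (auto simp: powr_defect_def simp flip: of_nat_Suc)
  moreover have "(\<Sum>n\<in>{0}. - powr_defect n 0) = 1"
    by (simp add: powr_defect_def)
  ultimately show ?thesis
    unfolding zeta_numerator_def by (simp add: sums_iff)
qed

text \<open>The right-hand side is \<open>- zeta'\<close>. The product form gives the logarithmic
  derivative without dividing by zeta, whose zeros are still unknown at this point.\<close>

lemma dirichlet_mangoldt_times_zeta:
  assumes "Re s > 1"
  shows "dirichlet mangoldt s * zeta s = dirichlet (\<lambda>n. of_real (ln (real n))) s"
proof -
  have "dirichlet mangoldt s * zeta s = dirichlet (\<lambda>n. \<Sum>d | d dvd n. mangoldt d * 1) s"
    by (rule dirichlet_mult[OF _ dirichlet_summable_1 assms])
       (rule dirichlet_summable_comparison[OF dirichlet_summable_ln[OF dirichlet_summable_1]],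
        auto simp: mangoldt_le)
  also have "\<dots> = dirichlet (\<lambda>n. of_real (ln (real n))) s"
    unfolding dirichlet_def
  proof (rule suminf_cong)
    show "(\<Sum>d | d dvd n. mangoldt d * 1) * of_nat n powr (-s) = of_real (ln (real n)) * of_nat n powr (-s)" for n
      by (cases "n = 0") (simp_all add: mangoldt_sum)
  qed
  finally show ?thesis .
qed

lemma dirichlet_summable_mangoldt: "dirichlet_summable mangoldt"
  by (rule dirichlet_summable_comparison[OF dirichlet_summable_ln[OF dirichlet_summable_1]])
     (auto simp: mangoldt_le)

lemma has_field_derivative_zeta_numerator:
  assumes "Re s > 0"
  shows "(zeta_numerator has_field_derivative deriv zeta_numerator s) (at s)"
  by (rule holomorphic_derivI[OF holomorphic_zeta_numerator open_halfspace_Re_gt]) (use assms in simp)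

text \<open>The value is \<open>1 / k\<close> at a prime power \<open>p ^ k\<close> and
  \<open>0\<close> elsewhere: the coefficients of the logarithm of the Euler product. At
  \<open>n = 1\<close> the quotient is \<open>0 / 0 = 0\<close>.\<close>

definition log_zeta_coeff :: "nat \<Rightarrow> real" where
  "log_zeta_coeff n = mangoldt n / ln (real n)"

lemma log_zeta_coeff_nonneg: "log_zeta_coeff n \<ge> 0"
  by (cases "n = 0") (auto simp: log_zeta_coeff_def mangoldt_nonneg)

abbreviation log_zeta :: "complex \<Rightarrow> complex" where
  "log_zeta \<equiv> dirichlet (\<lambda>n. of_real (log_zeta_coeff n))"

lemma dirichlet_summable_log_zeta: "dirichlet_summable (\<lambda>n. of_real (log_zeta_coeff n))"
proof (rule dirichlet_summable_bounded)
  fix n :: nat assume n: "n > 0"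
  show "norm (complex_of_real (log_zeta_coeff n)) \<le> 1"
  proof (cases "n = 1")
    case False
    with n have "ln (real n) > 0" by simp
    with mangoldt_le[OF n] have "log_zeta_coeff n \<le> 1"
      by (simp add: log_zeta_coeff_def)
    then show ?thesis
      using log_zeta_coeff_nonneg[of n] by simp
  qed (simp add: log_zeta_coeff_def)
qed

lemma has_field_derivative_log_zeta:
  assumes "Re s > 1"
  shows "(log_zeta has_field_derivative - dirichlet mangoldt s) (at s)"
proof -
  have "of_real (ln (real n)) * of_real (log_zeta_coeff n) = (mangoldt n :: complex)" for n
  proof (cases "n \<le> 1")
    case True
    then have "n = 0 \<or> n = 1" by linarith
    then show ?thesis by (auto simp: log_zeta_coeff_def)
  next
    case False
    then have "ln (real n) \<noteq> 0" by simp
    then show ?thesis by (simp add: log_zeta_coeff_def)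
  qed
  with has_field_derivative_dirichlet[OF dirichlet_summable_log_zeta assms] show ?thesis
    by simp
qed

lemma has_field_derivative_zeta:
  assumes "Re s > 1"
  shows "(zeta has_field_derivative - dirichlet mangoldt s * zeta s) (at s)"
  using has_field_derivative_dirichlet[OF dirichlet_summable_1 assms] dirichlet_mangoldt_times_zeta[OF assms]
  by simp

text \<open>The quotient of both sides has derivative \<open>0\<close>; this replaces the Euler product.\<close>
lemma zeta_eq_exp_log_zeta:
  obtains c where "c \<noteq> 0" "\<And>s. Re s > 1 \<Longrightarrow> zeta s = c * exp (log_zeta s)"
proof -
  define S where "S = {s. Re s > 1}"
  have S: "open S" "convex S"
    unfolding S_def by (auto intro: open_halfspace_Re_gt convex_halfspace_Re_gt)
  define q where "q = (\<lambda>s. zeta s * exp (- log_zeta s))"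
  have "(q has_field_derivative 0) (at s within S)" if "s \<in> S" for s
  proof -
    have s: "Re s > 1" using that by (simp add: S_def)
    have "(q has_field_derivative (- dirichlet mangoldt s * zeta s) * exp (- log_zeta s) + exp (- log_zeta s) * (- (- dirichlet mangoldt s)) * zeta s) (at s)"
      unfolding q_def
      by (intro DERIV_mult has_field_derivative_zeta[OF s] DERIV_fun_exp DERIV_minus has_field_derivative_log_zeta[OF s])
    then have "(q has_field_derivative 0) (at s)"
      by (simp add: algebra_simps)
    then show ?thesis
      by (rule has_field_derivative_at_within)
  qed
  then obtain c where c: "\<And>s. s \<in> S \<Longrightarrow> q s = c"
    using has_field_derivative_zero_constant[OF S(2)] by blast
  have eq: "zeta s = c * exp (log_zeta s)" if "Re s > 1" for s
  proof -
    have "zeta s = q s * exp (log_zeta s)"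
      by (simp add: q_def mult.assoc flip: exp_add)
    then show ?thesis using c[of s] that by (simp add: S_def)
  qed
  \<comment> \<open>If \<open>c\<close> were \<open>0\<close>, then \<open>zeta_numerator\<close>
    would vanish at points approaching \<open>1\<close> from the right, although it is continuous
    with value \<open>1\<close> there.\<close>
  moreover have "c \<noteq> 0"
  proof
    assume "c = 0"
    have "(\<lambda>n. zeta_numerator (1 + of_real (1 / real (Suc n)))) = (\<lambda>_. 0)"
      using eq \<open>c = 0\<close> by (auto simp: zeta_numerator_eq)
    moreover have "isCont zeta_numerator 1"
      by (rule DERIV_isCont[OF has_field_derivative_zeta_numerator]) simp
    moreover have "(\<lambda>n. 1 + complex_of_real (1 / real (Suc n))) \<longlonglongrightarrow> 1 + of_real 0"
      using LIMSEQ_inverse_real_of_nat by (intro tendsto_intros) (simp add: inverse_eq_divide)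
    ultimately have "(\<lambda>_. 0) \<longlonglongrightarrow> zeta_numerator 1"
      using isCont_tendsto_compose[of 1 zeta_numerator "\<lambda>n. 1 + complex_of_real (1 / real (Suc n))"] by simp
    then have "zeta_numerator 1 = 0"
      by (simp add: LIMSEQ_const_iff)
    then show False by (simp add: zeta_numerator_1)
  qed
  ultimately show thesis using that by blast
qed

section \<open>Nonvanishing of zeta on the closed half plane\<close>

lemma norm_zeta_eq:
  assumes "Re s > 1"
  shows "norm (zeta s) = norm (zeta_numerator s) / norm (s - 1)"
proof -
  have "s \<noteq> 1" using assms by auto
  then show ?thesis using assms by (simp add: zeta_numerator_eq norm_mult)
qed

lemma Re_log_zeta_sums:
  assumes "\<sigma> > 1"
  shows "(\<lambda>n. log_zeta_coeff n * real n powr (-\<sigma>) * cos (t * ln (real n))) sums Re (log_zeta (of_real \<sigma> + \<i> * of_real t))"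
proof -
  have "(\<lambda>n. Re (of_real (log_zeta_coeff n) * of_nat n powr (-(of_real \<sigma> + \<i> * of_real t)))) sums Re (log_zeta (of_real \<sigma> + \<i> * of_real t))"
    using assms by (intro sums_Re dirichlet_sums dirichlet_summable_log_zeta) auto
  moreover have "Re (of_real (log_zeta_coeff n) * of_nat n powr (-(of_real \<sigma> + \<i> * of_real t))) =
      log_zeta_coeff n * real n powr (-\<sigma>) * cos (t * ln (real n))" for n
    by (cases "n = 0") (auto simp: powr_def Ln_of_nat Re_exp algebra_simps)
  ultimately show ?thesis by (simp only:)
qed

text \<open>As the coefficients are nonnegative, it suffices that
  \<open>3 + 4 * cos y + cos (2 * y)\<close> is the nonnegative number
  \<open>2 * (1 + cos y)^2\<close> for each term.\<close>

lemma three_four_one_log_zeta: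
  assumes "\<sigma> > 1"
  shows "3 * Re (log_zeta (of_real \<sigma>)) + 4 * Re (log_zeta (of_real \<sigma> + \<i> * of_real t)) +
         Re (log_zeta (of_real \<sigma> + \<i> * of_real (2 * t))) \<ge> 0"
proof -
  let ?a = "\<lambda>n. log_zeta_coeff n * real n powr (-\<sigma>)"
  have A: "(\<lambda>n. 3 * (?a n * cos (0 * ln (real n))) + 4 * (?a n * cos (t * ln (real n))) + ?a n * cos ((2 * t) * ln (real n))) sums
     (3 * Re (log_zeta (of_real \<sigma> + \<i> * of_real 0)) + 4 * Re (log_zeta (of_real \<sigma> + \<i> * of_real t)) +
         Re (log_zeta (of_real \<sigma> + \<i> * of_real (2 * t))))"
    by (intro sums_add sums_mult Re_log_zeta_sums assms)
  have B: "3 * (?a n * cos (0 * ln (real n))) + 4 * (?a n * cos (t * ln (real n))) + ?a n * cos ((2 * t) * ln (real n)) \<ge> 0" for n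
  proof -
    define y where "y = t * ln (real n)"
    have "3 * (?a n * cos (0 * ln (real n))) + 4 * (?a n * cos (t * ln (real n))) + ?a n * cos ((2 * t) * ln (real n))
        = ?a n * (3 + 4 * cos y + cos (2 * y))"
      by (simp add: y_def algebra_simps)
    also have "3 + 4 * cos y + cos (2 * y) = 2 * (1 + cos y)\<^sup>2"
      unfolding cos_double_cos by (simp add: power2_eq_square algebra_simps)
    finally show ?thesis
      by (simp add: log_zeta_coeff_nonneg)
  qed
  from sums_le[OF B sums_zero A] show ?thesis by simp
qed

text \<open>For \<open>Re s > 1\<close> the exponential form of zeta excludes zeros. On the line, a
  zero at \<open>1 + \<i> * t\<close> would enter with power \<open>4\<close> against the pole at
  \<open>1\<close> with power \<open>3\<close>, so the product in the 3-4-1 inequality would tend to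
  \<open>0\<close> instead of staying above a positive constant.\<close>

lemma zeta_numerator_nonzero:
  assumes s: "Re s \<ge> 1"
  shows "zeta_numerator s \<noteq> 0"
proof
  assume zero: "zeta_numerator s = 0"
  obtain c where c: "c \<noteq> 0" "\<And>s. Re s > 1 \<Longrightarrow> zeta s = c * exp (log_zeta s)"
    using zeta_eq_exp_log_zeta by blast
  have "Re s = 1"
  proof (rule ccontr)
    assume "Re s \<noteq> 1"
    with s have "Re s > 1" by simp
    with zero c show False by (auto simp: zeta_numerator_eq)
  qed
  define t where "t = Im s"
  have s_eq: "s = 1 + \<i> * of_real t"
    using \<open>Re s = 1\<close> by (simp add: complex_eq_iff t_def)
  \<comment> \<open>Keeps both \<open>1 + \<i> * t\<close> and \<open>1 + \<i> * 2 * t\<close> away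
    from the pole, so that the denominators in \<open>?f\<close> have nonzero limits.\<close>
  have "t \<noteq> 0" using zero zeta_numerator_1 s_eq by auto
  have cont: "isCont zeta_numerator z" if "Re z > 0" for z
    using has_field_derivative_zeta_numerator[OF that] by (rule DERIV_isCont)
  let ?N = "zeta_numerator"
  \<comment> \<open>This is \<open>|zeta (1 + x)|^3 * |zeta (s + x)|^4 * |zeta (1 + 2 * \<i> * t +
    x)|\<close> for \<open>x > 0\<close>. The assumed zero turns
    \<open>zeta_numerator (s + x)\<close> into \<open>x\<close> times a difference quotient; of the
    resulting \<open>x^4\<close> the pole cancels \<open>x^3\<close>, and one factor
    \<open>x\<close> survives.\<close>
  let ?f = "\<lambda>x. norm (?N (1 + of_real x)) ^ 3 * x * norm ((?N (s + of_real x) - ?N s) / of_real x) ^ 4 / norm (of_real x + \<i> * of_real t) ^ 4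
     * norm (?N (1 + \<i> * of_real (2 * t) + of_real x)) / norm (of_real x + \<i> * of_real (2 * t))"
  have lim: "(?f \<longlongrightarrow> norm (?N 1) ^ 3 * 0 * norm (deriv ?N s) ^ 4 / norm (of_real 0 + \<i> * of_real t) ^ 4
     * norm (?N (1 + \<i> * of_real (2 * t))) / norm (of_real 0 + \<i> * of_real (2 * t))) (at_right 0)"
  proof (intro tendsto_mult tendsto_divide tendsto_power tendsto_norm tendsto_add tendsto_const tendsto_of_real tendsto_ident_at)
    have of_real: "filterlim (complex_of_real) (at 0) (at_right 0)"
      by (auto simp: filterlim_at intro!: tendsto_eq_intros) (auto simp: eventually_at_filter)
    have shift: "((\<lambda>x. z + complex_of_real x) \<longlongrightarrow> z) (at_right 0)" for z
      by (auto intro!: tendsto_eq_intros)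
    show "((\<lambda>x. ?N (1 + of_real x)) \<longlongrightarrow> ?N 1) (at_right 0)"
      "((\<lambda>x. ?N (1 + \<i> * of_real (2 * t) + of_real x)) \<longlongrightarrow> ?N (1 + \<i> * of_real (2 * t))) (at_right 0)"
      by (intro isCont_tendsto_compose[OF cont] shift; simp)+
    have "((\<lambda>h. (?N (s + h) - ?N s) / h) \<longlongrightarrow> deriv ?N s) (at 0)"
      using has_field_derivative_zeta_numerator[of s] \<open>Re s = 1\<close> by (simp add: DERIV_def)
    from filterlim_compose[OF this of_real]
    show "((\<lambda>x. (?N (s + of_real x) - ?N s) / of_real x) \<longlongrightarrow> deriv ?N s) (at_right 0)" .
  qed (use \<open>t \<noteq> 0\<close> in auto)
  \<comment> \<open>The exponent is \<open>8 = 3 + 4 + 1\<close>, one factor \<open>c\<close> for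
    each zeta factor.\<close>
  have "?f x \<ge> norm c ^ 8" if x: "x > 0" for x
  proof -
    define \<sigma> where "\<sigma> = 1 + x"
    have \<sigma>: "\<sigma> > 1" using x by (simp add: \<sigma>_def)
    have norm_zeta: "norm (zeta z) = norm c * exp (Re (log_zeta z))" if "Re z > 1" for z
      using c(2)[OF that] by (simp add: norm_mult)
    let ?a = "of_real \<sigma> :: complex" and ?b = "of_real \<sigma> + \<i> * of_real t" and ?d = "of_real \<sigma> + \<i> * of_real (2 * t)"
    have "norm c ^ 8 * 1 \<le> norm c ^ 8 * exp (3 * Re (log_zeta ?a) + 4 * Re (log_zeta ?b) + Re (log_zeta ?d))"
      using three_four_one_log_zeta[OF \<sigma>, of t] by (intro mult_left_mono) auto
    also have "\<dots> = norm (zeta ?a) ^ 3 * norm (zeta ?b) ^ 4 * norm (zeta ?d)"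
    proof -
      have "exp (3 * x + 4 * y + z) = exp x ^ 3 * exp y ^ 4 * exp z" for x y z :: real
        by (simp add: exp_add flip: exp_of_nat_mult)
      moreover have "n ^ 8 * (x ^ 3 * y ^ 4 * z) = (n * x) ^ 3 * (n * y) ^ 4 * (n * z)" for n x y z :: real
        by algebra
      moreover have "Re ?a > 1" "Re ?b > 1" "Re ?d > 1" using \<sigma> by simp_all
      ultimately show ?thesis by (simp only: norm_zeta)
    qed
    also have "norm (zeta ?a) = norm (?N (1 + of_real x)) / x"
      using x \<sigma> by (simp add: norm_zeta_eq) (simp add: \<sigma>_def)
    also have "norm (zeta ?b) = norm (?N (s + of_real x) - ?N s) / norm (of_real x + \<i> * of_real t)"
    proof -
      have "?b = s + of_real x" "s + of_real x - 1 = of_real x + \<i> * of_real t"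
        by (simp_all add: s_eq \<sigma>_def)
      moreover have "Re ?b > 1" using \<sigma> by simp
      ultimately show ?thesis
        by (simp only: norm_zeta_eq) (simp only: zero diff_zero)
    qed
    also have "norm (zeta ?d) = norm (?N (1 + \<i> * of_real (2 * t) + of_real x)) / norm (of_real x + \<i> * of_real (2 * t))"
    proof -
      have "?d = 1 + \<i> * of_real (2 * t) + of_real x" "1 + \<i> * of_real (2 * t) + of_real x - 1 = of_real x + \<i> * of_real (2 * t)"
        by (simp_all add: \<sigma>_def)
      moreover have "Re ?d > 1" using \<sigma> by simp
      ultimately show ?thesis by (simp only: norm_zeta_eq)
    qed
    finally show ?thesis
      using x by (simp add: norm_divide power_divide field_simps power3_eq_cube power4_eq_xxxx)
  qed
  then have "\<forall>\<^sub>F x in at_right 0. ?f x \<ge> norm c ^ 8"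
    by (auto simp: eventually_at_filter)
  from tendsto_lowerbound[OF lim this] c(1) show False by simp
qed

subsection \<open>The Chebyshev function\<close>

definition psi :: "nat \<Rightarrow> real" where
  "psi n = (\<Sum>d\<le>n. mangoldt d)"

lemma psi_mono: "mono psi"
  unfolding psi_def by (intro monoI sum_mono2) (auto simp: mangoldt_nonneg)

lemma psi_nonneg: "psi n \<ge> 0"
  unfolding psi_def by (intro sum_nonneg) (auto simp: mangoldt_nonneg)

text \<open>Passing from \<open>n\<close> to \<open>Suc n\<close> raises \<open>n div d\<close> by
  one exactly when \<open>d\<close> divides \<open>Suc n\<close>, and the values of
  \<open>mangoldt\<close> at those \<open>d\<close> add up to \<open>ln (Suc n)\<close>. The free
  range \<open>M\<close> allows two factorials to be expanded over the same index set.\<close>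

lemma ln_fact_eq_sum_mangoldt:
  "n \<le> M \<Longrightarrow> ln (fact n) = (\<Sum>d\<in>{1..M}. mangoldt d * real (n div d))"
proof (induction n)
  case (Suc n)
  have div: "Suc n div d = n div d + (if d dvd Suc n then 1 else 0)" for d
    by (simp add: div_Suc dvd_eq_mod_eq_0)
  have "(\<Sum>d\<in>{1..M}. mangoldt d * real (Suc n div d)) =
      (\<Sum>d\<in>{1..M}. mangoldt d * real (n div d)) + (\<Sum>d\<in>{1..M}. if d dvd Suc n then mangoldt d else 0)"
    unfolding div by (simp add: algebra_simps if_distrib flip: sum.distrib cong: if_cong)
  also have "(\<Sum>d\<in>{1..M}. if d dvd Suc n then mangoldt d else 0) = (\<Sum>d | d dvd Suc n. mangoldt d :: real)"
  proof (rule sum.mono_neutral_cong_right)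
    show "{d. d dvd Suc n} \<subseteq> {1..M}"
    proof safe
      fix d assume d: "d dvd Suc n"
      then have "d \<noteq> 0" by (intro notI) simp
      moreover have "d \<le> Suc n" using d by (rule dvd_imp_le) simp
      ultimately show "d \<in> {1..M}" using Suc.prems by simp
    qed
  qed auto
  also have "\<dots> = ln (real (Suc n))"
    by (subst mangoldt_sum) auto
  also have "(\<Sum>d\<in>{1..M}. mangoldt d * real (n div d)) = ln (fact n)"
    using Suc by simp
  also have "ln (fact n) + ln (real (Suc n)) = ln (fact (Suc n))"
    by (simp add: ln_mult del: of_nat_Suc)
  finally show ?case ..
qed simp

text \<open>In the expansion of \<open>ln (2 * n choose n)\<close> the coefficient of
  \<open>mangoldt d\<close> is nonnegative for every \<open>d\<close> and at least \<open>1\<close>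
  for \<open>n < d <= 2 * n\<close>. The binomial coefficient is at most \<open>2 ^ (2 * n)\<close>,
  and \<open>ln 2 <= 1\<close>.\<close>

lemma psi_double_le: "psi (2 * n) \<le> psi n + 2 * real n"
proof -
  have "psi (2 * n) - psi n = (\<Sum>d\<in>{n<..2*n}. mangoldt d)"
  proof -
    have *: "{..2*n} = {..n} \<union> {n<..2*n}" by auto
    have "(\<Sum>d\<in>{..n} \<union> {n<..2*n}. mangoldt d :: real) = (\<Sum>d\<le>n. mangoldt d) + (\<Sum>d\<in>{n<..2*n}. mangoldt d)"
      by (rule sum.union_disjoint) auto
    then show ?thesis unfolding psi_def * by simp
  qed
  also have "\<dots> \<le> (\<Sum>d\<in>{1..2*n}. mangoldt d * (real (2 * n div d) - 2 * real (n div d)))"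
  proof (rule sum_mono2[THEN order_trans[rotated]])
    show "(\<Sum>d\<in>{n<..2*n}. mangoldt d) \<le> (\<Sum>d\<in>{n<..2*n}. mangoldt d * (real (2 * n div d) - 2 * real (n div d)))"
    proof (rule sum_mono)
      fix d assume d: "d \<in> {n<..2*n}"
      then have "2 * n div d \<ge> 1" "n div d = 0"
        by (auto simp: Suc_le_eq div_greater_zero_iff)
      then have "real (2 * n div d) - 2 * real (n div d) \<ge> 1" by simp
      then show "mangoldt d \<le> mangoldt d * (real (2 * n div d) - 2 * real (n div d))"
        using mult_left_mono[of 1 "real (2 * n div d) - 2 * real (n div d)" "mangoldt d"] by (simp add: mangoldt_nonneg)
    qed
    show "0 \<le> mangoldt d * (real (2 * n div d) - 2 * real (n div d))" for d
    proof -
      have "2 * (n div d) \<le> 2 * n div d"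
        by (cases "d = 0") (auto simp: less_eq_div_iff_mult_less_eq intro: div_times_less_eq_dividend order_trans)
      then show ?thesis
        by (intro mult_nonneg_nonneg mangoldt_nonneg) (simp flip: of_nat_mult)
    qed
  qed auto
  also have "\<dots> = ln (fact (2 * n)) - 2 * ln (fact n)"
    by (subst (1 2) ln_fact_eq_sum_mangoldt[of _ "2 * n"])
       (auto simp: sum_distrib_left algebra_simps simp flip: sum_subtractf)
  also have "\<dots> = ln (real (2 * n choose n))"
    by (simp add: binomial_fact ln_div ln_mult)
  also have "\<dots> \<le> ln (2 ^ (2 * n))"
  proof (rule ln_mono)
    have "real (2 * n choose n) \<le> real (2 ^ (2 * n))"
      using binomial_le_pow2 by (rule of_nat_mono)
    then show "real (2 * n choose n) \<le> 2 ^ (2 * n)" by simp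
  qed (simp add: zero_less_binomial)
  also have "\<dots> = 2 * real n * ln 2"
    by (simp add: ln_realpow)
  also have "\<dots> \<le> 2 * real n * 1"
    using ln_less_self[of "2::real"] ln_add_one_self_le_self[of "1::real"] by (intro mult_left_mono) auto
  finally show ?thesis by simp
qed

text \<open>Halving with rounding up gives \<open>6 * m <= 3 * (n + 1)\<close>, which is at most
  \<open>4 * n\<close> once \<open>n >= 3\<close>; smaller \<open>n\<close> are the base
  cases.\<close>

lemma psi_le: "psi n \<le> 4 * real n"
proof (induction n rule: less_induct)
  case (less n)
  have psi_1: "psi 1 = 0" by (simp add: psi_def)
  consider "n \<le> 1" | "n = 2" | "n \<ge> 3" by linarith
  then show ?case
  proof cases
    case 1
    then have "psi n \<le> psi 1" using psi_mono by (auto simp: mono_def)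
    with psi_1 show ?thesis by simp
  next
    case 2
    with psi_double_le[of 1] psi_1 show ?thesis by simp
  next
    case 3
    define m where "m = (n + 1) div 2"
    have m: "m < n" "n \<le> 2 * m" "2 * m \<le> n + 1" "m \<ge> 2" using 3 by (auto simp: m_def)
    have "psi n \<le> psi (2 * m)" using psi_mono m by (auto simp: mono_def)
    also have "\<dots> \<le> psi m + 2 * real m" by (rule psi_double_le)
    also have "\<dots> \<le> 6 * real m" using less[OF m(1)] by simp
    also have "\<dots> \<le> 4 * real n" using m by linarith
    finally show ?thesis .
  qed
qed

lemma abs_psi_diff_le: "\<bar>psi n - real n\<bar> \<le> 4 * real n"
  using psi_le[of n] psi_nonneg[of n] by linarith

text \<open>If \<open>f N\<close> exceeds \<open>(1 + 2 * d) * N\<close>, monotonicity keeps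
  \<open>f n - n\<close> above \<open>d * N\<close> for \<open>N <= n <= (1 + d) * N\<close>. There
  each term is at least \<open>d / (4 * N)\<close>, so this block adds up to at least
  \<open>d^2 / 4\<close>, against the Cauchy criterion. A deficit is treated in the same way on a
  block to the left of \<open>N\<close>.\<close>

lemma tendsto_1_if_summable_diff:
  fixes f :: "nat \<Rightarrow> real"
  assumes mono: "mono f" and sum: "summable (\<lambda>n. (f n - real n) / (real n)\<^sup>2)"
  shows "(\<lambda>n. f n / real n) \<longlonglongrightarrow> 1"
proof (rule LIMSEQ_I)
  define g where "g = (\<lambda>n. (f n - real n) / (real n)\<^sup>2)"
  fix e :: real assume "e > 0"
  define d where "d = min (e / 4) (1 / 2)"
  have d: "d > 0" "d \<le> 1 / 2" "2 * d < e" using \<open>e > 0\<close> by (auto simp: d_def min_def)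
  have d2: "d\<^sup>2 / 4 > 0" using d by simp
  then obtain N0 where N0: "\<And>m n. m \<ge> N0 \<Longrightarrow> \<bar>sum g {m..<n}\<bar> < d\<^sup>2 / 4"
    using sum unfolding summable_Cauchy g_def by (metis real_norm_def)
  \<comment> \<open>The left block starts at \<open>N - K >= N / 2\<close>, which has to be beyond
    \<open>N0\<close>.\<close>
  have "\<bar>f N / real N - 1\<bar> < e" if N: "N \<ge> 2 * N0 + 1" for N
  proof -
    \<comment> \<open>Each block has \<open>K + 1\<close> elements, more than
      \<open>d * N\<close>.\<close>
    define K where "K = nat \<lfloor>d * real N\<rfloor>"
    have K: "real K \<le> d * real N" "d * real N < real K + 1"
      using d by (auto simp: K_def)
    have "d * real N \<le> real N / 2" using d mult_right_mono[of d "1/2" "real N"] by simp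
    then have K_le: "2 * K \<le> N" using K by linarith
    have "N > 0" using N by simp
    have upper: "f N < (1 + 2 * d) * real N"
    proof (rule ccontr)
      assume "\<not> f N < (1 + 2 * d) * real N"
      then have f: "f N \<ge> real N + 2 * d * real N" by (simp add: algebra_simps)
      have "d / (4 * real N) \<le> g n" if "n \<in> {N..<N + K + 1}" for n
      proof -
        have n: "N \<le> n" "real n \<le> real N + d * real N" using that K by auto
        have "f N \<le> f n" using mono n by (auto simp: mono_def)
        then have 1: "d * real N \<le> f n - real n" using f n by linarith
        have "real n \<le> 2 * real N" using n \<open>d * real N \<le> real N / 2\<close> by linarith
        then have 2: "(real n)\<^sup>2 \<le> (2 * real N)\<^sup>2" by (intro power_mono) auto
        have "d / (4 * real N) = (d * real N) / (2 * real N)\<^sup>2"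
          using \<open>N > 0\<close> by (simp add: power2_eq_square field_simps)
        also have "\<dots> \<le> (f n - real n) / (real n)\<^sup>2"
          using 1 2 d \<open>N > 0\<close> n by (intro frac_le) auto
        finally show ?thesis by (simp add: g_def)
      qed
      then have "(\<Sum>n\<in>{N..<N + K + 1}. d / (4 * real N)) \<le> sum g {N..<N + K + 1}"
        by (rule sum_mono)
      moreover have "d\<^sup>2 / 4 \<le> (\<Sum>n\<in>{N..<N + K + 1}. d / (4 * real N))"
      proof -
        have "d\<^sup>2 / 4 = (d * real N) * (d / (4 * real N))"
          using \<open>N > 0\<close> by (simp add: power2_eq_square)
        also have "\<dots> \<le> (real K + 1) * (d / (4 * real N))"
          using K d by (intro mult_right_mono) auto
        finally show ?thesis by (simp add: add.commute)
      qed
      moreover have "sum g {N..<N + K + 1} < d\<^sup>2 / 4"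
        using N0[of N "N + K + 1"] N by linarith
      ultimately show False by linarith
    qed
    have lower: "f N > (1 - 2 * d) * real N"
    proof (rule ccontr)
      assume "\<not> f N > (1 - 2 * d) * real N"
      then have f: "f N \<le> real N - 2 * d * real N" by (simp add: algebra_simps)
      have "g n \<le> - (d / real N)" if "n \<in> {N - K..<N + 1}" for n
      proof -
        have n: "n \<le> N" "real n \<ge> real N - d * real N" "n > 0" using that K K_le \<open>N > 0\<close> by auto
        have "f n \<le> f N" using mono n by (auto simp: mono_def)
        then have 1: "d * real N \<le> real n - f n" using f n by linarith
        have 2: "(real n)\<^sup>2 \<le> (real N)\<^sup>2" using n by (intro power_mono) auto
        have "d / real N = (d * real N) / (real N)\<^sup>2"
          using \<open>N > 0\<close> by (simp add: power2_eq_square)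
        also have "\<dots> \<le> (real n - f n) / (real n)\<^sup>2"
          using 1 2 d \<open>N > 0\<close> n by (intro frac_le) auto
        also have "\<dots> = - g n" by (simp add: g_def minus_divide_left)
        finally show ?thesis by simp
      qed
      then have "sum g {N - K..<N + 1} \<le> (\<Sum>n\<in>{N - K..<N + 1}. - (d / real N))"
        by (rule sum_mono)
      moreover have "(\<Sum>n\<in>{N - K..<N + 1}. - (d / real N)) \<le> - (d\<^sup>2)"
      proof -
        have "d\<^sup>2 = (d * real N) * (d / real N)"
          using \<open>N > 0\<close> by (simp add: power2_eq_square)
        also have "\<dots> \<le> (real K + 1) * (d / real N)"
          using K d by (intro mult_right_mono) auto
        finally show ?thesis using K_le by (simp add: of_nat_diff add.commute)
      qed
      moreover have "- (d\<^sup>2 / 4) < sum g {N - K..<N + 1}"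
        using N0[of "N - K" "N + 1"] N K_le by linarith
      ultimately show False using d2 by linarith
    qed
    have "\<bar>f N / real N - 1\<bar> = \<bar>f N - real N\<bar> / real N"
      using \<open>N > 0\<close> by (simp add: field_simps abs_divide)
    also have "\<dots> < e"
    proof -
      have "\<bar>f N - real N\<bar> \<le> 2 * d * real N" using upper lower by (simp add: algebra_simps)
      also have "\<dots> < e * real N" using d \<open>N > 0\<close> by simp
      finally show ?thesis using \<open>N > 0\<close> by (simp add: field_simps)
    qed
    finally show ?thesis .
  qed
  then show "\<exists>no. \<forall>n\<ge>no. norm (f n / real n - 1) < e"
    by (auto simp: real_norm_def)
qed

text \<open>Summation by parts with \<open>psi n - n\<close> as the partial sum of
  \<open>mangoldt n - 1\<close>. The boundary term tends to \<open>0\<close> because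
  \<open>psi N - N\<close> is of order at most \<open>N\<close> and \<open>Re s > 1\<close>.\<close>

lemma Chebyshev_error_sums:
  assumes s: "Re s > 1"
  shows "(\<lambda>n. of_real (psi n - real n) * (of_nat n powr (-s) - of_nat (Suc n) powr (-s)))
           sums (dirichlet mangoldt s - zeta s)"
proof -
  define C where "C = (\<lambda>n. psi n - real n)"
  have "(\<lambda>n. mangoldt n * of_nat n powr (-s) - 1 * of_nat n powr (-s)) sums (dirichlet mangoldt s - zeta s)"
    using s by (intro sums_diff dirichlet_sums dirichlet_summable_mangoldt dirichlet_summable_1)
  then have "(\<lambda>N. \<Sum>n\<le>N. mangoldt n * of_nat n powr (-s) - 1 * of_nat n powr (-s)) \<longlonglongrightarrow> dirichlet mangoldt s - zeta s"
    by (simp add: sums_def_le)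
  moreover have "(\<lambda>N. of_real (C N) * of_nat (Suc N) powr (-s)) \<longlonglongrightarrow> 0"
  proof (rule Lim_null_comparison)
    show "\<forall>\<^sub>F N in sequentially. norm (of_real (C N) * of_nat (Suc N) powr (-s)) \<le> 4 * real (Suc N) powr (-(Re s - 1))"
    proof (rule always_eventually, rule allI)
      fix N
      have "\<bar>C N\<bar> \<le> 4 * real N"
        using abs_psi_diff_le[of N] by (simp add: C_def)
      then have "norm (of_real (C N) * of_nat (Suc N) powr (-s)) \<le> 4 * real (Suc N) * real (Suc N) powr (- Re s)"
        unfolding norm_mult norm_nat_powr by (intro mult_mono) auto
      also have "\<dots> = 4 * (real (Suc N) powr 1 * real (Suc N) powr (- Re s))"
        by simp
      also have "\<dots> = 4 * real (Suc N) powr (-(Re s - 1))"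
        by (simp only: powr_add [symmetric]) simp
      finally show "norm (of_real (C N) * of_nat (Suc N) powr (-s)) \<le> 4 * real (Suc N) powr (-(Re s - 1))" .
    qed
    have "(\<lambda>N. real (Suc N) powr (-(Re s - 1))) \<longlonglongrightarrow> 0"
      using s by (intro tendsto_neg_powr filterlim_compose[OF filterlim_real_sequentially filterlim_Suc]) auto
    then show "(\<lambda>N. 4 * real (Suc N) powr (-(Re s - 1))) \<longlonglongrightarrow> 0"
      by (rule tendsto_mult_right_zero)
  qed
  ultimately have "(\<lambda>N. (\<Sum>n\<le>N. mangoldt n * of_nat n powr (-s) - 1 * of_nat n powr (-s)) - of_real (C N) * of_nat (Suc N) powr (-s))
      \<longlonglongrightarrow> dirichlet mangoldt s - zeta s - 0"
    by (rule tendsto_diff)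
  moreover have "(\<Sum>n\<le>N. mangoldt n * of_nat n powr (-s) - 1 * of_nat n powr (-s)) - of_real (C N) * of_nat (Suc N) powr (-s) =
      (\<Sum>n\<le>N. of_real (C n) * (of_nat n powr (-s) - of_nat (Suc n) powr (-s)))" for N
  proof (induction N)
    case 0
    show ?case by (simp add: C_def psi_def)
  next
    case (Suc N)
    have *: "complex_of_real (C (Suc N)) = of_real (C N) + mangoldt (Suc N) - 1"
      by (simp add: C_def psi_def)
    show ?case using Suc by (simp add: * algebra_simps del: of_nat_Suc)
  qed
  ultimately show ?thesis
    by (simp add: sums_def_le C_def)
qed

theorem summable_Chebyshev_error: "summable (\<lambda>n. (psi n - real n) / (real n)\<^sup>2)"
proof -
  define C where "C = (\<lambda>n. complex_of_real (psi n - real n))"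
  \<comment> \<open>The error made when \<open>n^(-s) - (n+1)^(-s)\<close> is replaced by
    \<open>s * n^(-s-1)\<close>. The factor \<open>C n\<close> costs one power of \<open>n\<close>
    and the defect gains one, so \<open>E\<close> is holomorphic for
    \<open>Re s > 0\<close>.\<close>
  define E where "E = (\<lambda>s. \<Sum>n. C n * powr_defect n s)"
  have C_bound: "norm (C n) \<le> 4 * real n" for n
    using abs_psi_diff_le[of n] by (simp only: C_def norm_of_real)
  have hol: "(\<lambda>s. C n * powr_defect n s) holomorphic_on {s. Re s > 0}" for n
    by (intro holomorphic_intros)
  have bound: "norm (C n * powr_defect n s) \<le> 4 * (norm s + 1)\<^sup>2 * real n powr (- Re s - 1)"
    if "n > 0" "Re s > 0" for n s
  proof -
    have "norm (C n * powr_defect n s) \<le> (4 * real n) * (norm s * norm (s + 1) * real n powr (- Re s - 2))"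
      unfolding norm_mult using that by (intro mult_mono C_bound norm_powr_defect_le) auto
    also have "\<dots> \<le> (4 * real n) * ((norm s + 1) * (norm s + 1) * real n powr (- Re s - 2))"
      using norm_triangle_ineq[of s 1] by (intro mult_left_mono mult_right_mono mult_mono) auto
    also have "\<dots> = 4 * (norm s + 1)\<^sup>2 * (real n powr 1 * real n powr (- Re s - 2))"
      using that by (simp add: power2_eq_square)
    also have "real n powr 1 * real n powr (- Re s - 2) = real n powr (- Re s - 1)"
    proof -
      have "1 + (- Re s - 2) = - Re s - 1" by simp
      then show ?thesis by (simp only: powr_add [symmetric])
    qed
    finally show ?thesis .
  qed
  have E_hol: "E holomorphic_on {s. Re s > 0}"
    unfolding E_def by (rule holomorphic_suminf_half_plane[OF hol _ bound]) auto
  have E_sums: "(\<lambda>n. C n * powr_defect n s) sums E s" if "Re s > 0" for s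
    unfolding E_def by (rule sums_suminf_half_plane[OF hol _ bound]) (use that in auto)
  let ?N = zeta_numerator
  define H where "H = {s. Re s > 0}"
  have H: "open H" unfolding H_def by (rule open_halfspace_Re_gt)
  have N_hol: "?N holomorphic_on H"
    unfolding H_def by (rule holomorphic_zeta_numerator)
  define U where "U = H \<inter> ?N -` (- {0})"
  have "open U"
    unfolding U_def by (intro continuous_open_preimage holomorphic_on_imp_continuous_on N_hol H) auto
  have U_sub: "U \<subseteq> H" by (auto simp: U_def)
  have one_sub: "{s. Re s \<ge> 1} \<subseteq> U"
    using zeta_numerator_nonzero by (auto simp: U_def H_def)
  \<comment> \<open>\<open>zeta s - 1 / (s - 1)\<close> with the singularity removed, since
    \<open>zeta_numerator 1 = 1\<close>.\<close>
  define M where "M = (\<lambda>s. if s = 1 then deriv ?N 1 else (?N s - ?N 1) / (s - 1))"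
  have M_hol: "M holomorphic_on H"
    unfolding M_def by (rule pole_lemma_open[OF N_hol H])
  \<comment> \<open>The logarithmic derivative of \<open>(s - 1) * zeta s\<close> is
    \<open>1 / (s - 1) + zeta' / zeta\<close>. Together with the shape of \<open>M\<close>, the two
    terms \<open>1 / (s - 1)\<close> cancel, so \<open>- M - deriv ?N / ?N\<close> continues
    \<open>- zeta' / zeta - zeta\<close> across \<open>s = 1\<close>.\<close>
  define F where "F = (\<lambda>s. (- M s - deriv ?N s / ?N s - E s) / s)"
  have F_hol: "F holomorphic_on U"
    unfolding F_def
  proof (intro holomorphic_on_divide holomorphic_on_diff holomorphic_on_minus holomorphic_on_ident)
    show "M holomorphic_on U" "?N holomorphic_on U" "deriv ?N holomorphic_on U" "E holomorphic_on U"
      by (rule holomorphic_on_subset[OF _ U_sub],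
          rule M_hol N_hol holomorphic_deriv[OF N_hol H] E_hol[folded H_def])+
  qed (auto simp: U_def H_def)
  have F_sums: "(\<lambda>n. C n / of_nat n * of_nat n powr (-s)) sums F s" if s: "Re s > 1" for s
  proof -
    let ?D = "dirichlet mangoldt s"
    have "s \<noteq> 1" "s \<noteq> 0" using s by auto
    have N_s: "?N s = (s - 1) * zeta s" and "?N s \<noteq> 0"
      using s zeta_numerator_nonzero[of s] by (auto simp: zeta_numerator_eq)
    have "((\<lambda>s. (s - 1) * zeta s) has_field_derivative (zeta s + (s - 1) * (- ?D * zeta s))) (at s)"
      by (auto intro!: derivative_eq_intros has_field_derivative_zeta[OF s])
    then have "(?N has_field_derivative (zeta s + (s - 1) * (- ?D * zeta s))) (at s)"
      by (rule has_field_derivative_transform_within_open[where S = "{s. Re s > 1}"])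
         (use s in \<open>auto simp: zeta_numerator_eq open_halfspace_Re_gt\<close>)
    then have deriv: "deriv ?N s = zeta s + (s - 1) * (- ?D * zeta s)"
      by (rule DERIV_imp_deriv)
    have "- M s - deriv ?N s / ?N s = ?D - zeta s"
    proof -
      define u z where "u = s - 1" and "z = zeta s"
      have uz: "u \<noteq> 0" "z \<noteq> 0" using \<open>?N s \<noteq> 0\<close> N_s by (auto simp: u_def z_def)
      have "M s = (u * z - 1) / u"
        using \<open>s \<noteq> 1\<close> by (simp add: M_def N_s zeta_numerator_1 u_def z_def)
      also have "\<dots> = z - 1 / u"
        using uz by (simp add: field_simps)
      finally have M: "M s = z - 1 / u" .
      have "deriv ?N s / ?N s = (z + u * (- ?D * z)) / (u * z)"
        unfolding deriv N_s u_def z_def ..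
      also have "\<dots> = 1 / u - ?D"
        using uz by (simp add: field_simps)
      finally show ?thesis
        by (simp add: M z_def)
    qed
    then have F_s: "F s = (?D - zeta s - E s) / s" by (simp add: F_def)
    have "(\<lambda>n. (C n * (of_nat n powr (-s) - of_nat (Suc n) powr (-s)) - C n * powr_defect n s) / s) sums F s"
      unfolding F_s C_def
      by (intro sums_divide sums_diff Chebyshev_error_sums s E_sums[unfolded C_def]) (use s in simp)
    moreover have "(C n * (of_nat n powr (-s) - of_nat (Suc n) powr (-s)) - C n * powr_defect n s) / s = C n / of_nat n * of_nat n powr (-s)" for n
    proof (cases "n = 0")
      case False
      then have "(of_nat n :: complex) powr (-s - 1) = of_nat n powr (-s) / of_nat n"
        by (simp add: powr_diff)
      then show ?thesis
        using \<open>s \<noteq> 0\<close> by (simp add: powr_defect_def algebra_simps)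
    qed (simp add: C_def psi_def)
    ultimately show ?thesis by simp
  qed
  have "(\<lambda>n. (C n / of_nat n) / of_nat n) sums F 1"
  proof (rule Newman_Tauberian[OF _ \<open>open U\<close> one_sub F_hol F_sums])
    show "norm (C n / of_nat n) \<le> 4" for n
      using C_bound[of n] by (cases "n = 0") (auto simp: norm_divide field_simps)
  qed
  then have "summable (\<lambda>n. Re ((C n / of_nat n) / of_nat n))"
    using summable_Re sums_summable by blast
  moreover have "Re ((C n / of_nat n) / of_nat n) = (psi n - real n) / (real n)\<^sup>2" for n
    by (simp add: C_def power2_eq_square)
  ultimately show ?thesis by simp
qed

subsection \<open>The prime number theorem\<close>

definition primes_le :: "nat \<Rightarrow> nat set" where
  "primes_le n = {p. prime p \<and> p \<le> n}"

lemma finite_primes_le [simp]: "finite (primes_le n)"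
  unfolding primes_le_def by simp

text \<open>Grouping the prime powers up to \<open>n\<close> by their prime, each \<open>p\<close>
  contributes the logarithm of its largest power not exceeding \<open>n\<close>, hence at most
  \<open>ln n\<close>.\<close>

lemma psi_le_card_primes: "psi n \<le> real (card (primes_le n)) * ln (real n)"
proof -
  define S where "S = {d. d \<le> n \<and> primepow d}"
  have "psi n = (\<Sum>d\<in>S. mangoldt d)"
    unfolding psi_def S_def by (intro sum.mono_neutral_right) (auto simp: mangoldt_def)
  also have "\<dots> = (\<Sum>p\<in>primes_le n. \<Sum>d\<in>{d \<in> S. aprimedivisor d = p}. mangoldt d)"
  proof (rule sum.group [symmetric])
    show "aprimedivisor ` S \<subseteq> primes_le n"
    proof safe
      fix d assume "d \<in> S"
      then have d: "d \<le> n" "primepow d" by (auto simp: S_def)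
      then have "d > 1" using primepow_gt_Suc_0 by auto
      then have "prime (aprimedivisor d)" "aprimedivisor d \<le> d"
        by (auto intro!: prime_aprimedivisor' dvd_imp_le aprimedivisor_dvd')
      with d show "aprimedivisor d \<in> primes_le n" by (simp add: primes_le_def)
    qed
  qed (auto simp: S_def)
  also have "\<dots> \<le> (\<Sum>p\<in>primes_le n. ln (real n))"
  proof (rule sum_mono)
    fix p assume "p \<in> primes_le n"
    then have p: "prime p" "p \<le> n" by (auto simp: primes_le_def)
    then have "2 \<le> p" by (simp add: prime_ge_2_nat)
    then obtain k where k: "p ^ k \<le> n" "n < p ^ (k + 1)"
      using ex_power_ivl1[of p n] p by auto
    \<comment> \<open>The powers of \<open>p\<close> up to \<open>n\<close> are divisors of
      \<open>p ^ k\<close>, and \<open>mangoldt\<close> sums to \<open>ln (p ^ k)\<close> over these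
      divisors.\<close>
    have "(\<Sum>d\<in>{d \<in> S. aprimedivisor d = p}. mangoldt d) \<le> (\<Sum>d | d dvd p ^ k. mangoldt d :: real)"
    proof (rule sum_mono2)
      show "finite {d. d dvd p ^ k}" using \<open>2 \<le> p\<close> by simp
      show "{d \<in> S. aprimedivisor d = p} \<subseteq> {d. d dvd p ^ k}"
      proof safe
        fix d assume "d \<in> S" and p_eq: "p = aprimedivisor d"
        then have "d \<le> n" "primepow d" by (auto simp: S_def)
        then obtain j where j: "d = p ^ j"
          using primepow_decompose[of d] p_eq by metis
        have "p ^ j < p ^ (k + 1)" using j \<open>d \<le> n\<close> k by simp
        then have "j < k + 1" using \<open>2 \<le> p\<close> power_less_imp_less_exp[of p j "k + 1"] by linarith
        then have "j \<le> k" by simp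
        then have "d dvd p ^ k"
          unfolding j by (rule le_imp_power_dvd)
        then show "d dvd aprimedivisor d ^ k"
          by (simp only: p_eq)
      qed
    qed (auto simp: mangoldt_nonneg)
    also have "\<dots> = ln (real (p ^ k))"
      using \<open>2 \<le> p\<close> by (subst mangoldt_sum) auto
    also have "\<dots> \<le> ln (real n)"
      using k \<open>2 \<le> p\<close> by (intro ln_mono) auto
    finally show "(\<Sum>d\<in>{d \<in> S. aprimedivisor d = p}. mangoldt d) \<le> ln (real n)" .
  qed
  also have "\<dots> = real (card (primes_le n)) * ln (real n)" by simp
  finally show ?thesis .
qed

text \<open>Primes up to \<open>n powr (1 - d)\<close> are counted trivially; every larger one
  contributes more than \<open>(1 - d) * ln n\<close> to \<open>psi n\<close>.\<close>

lemma card_primes_le_le: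
  assumes d: "0 < d" "d < 1" and n: "n \<ge> 2"
  shows "real (card (primes_le n)) \<le> real n powr (1 - d) + psi n / ((1 - d) * ln (real n))"
proof -
  define y where "y = real n powr (1 - d)"
  define A where "A = {p \<in> primes_le n. real p \<le> y}"
  define B where "B = {p \<in> primes_le n. y < real p}"
  have ln_n: "ln (real n) > 0" using n by simp
  have "primes_le n = A \<union> B" "A \<inter> B = {}" "finite A" "finite B"
    by (auto simp: A_def B_def)
  then have card: "card (primes_le n) = card A + card B"
    by (metis card_Un_disjoint)
  have "A \<subseteq> {1..nat \<lfloor>y\<rfloor>}"
    by (auto simp: A_def primes_le_def le_nat_floor Suc_le_eq prime_gt_0_nat)
  then have "card A \<le> nat \<lfloor>y\<rfloor>"
    using card_mono[of "{1..nat \<lfloor>y\<rfloor>}" A] by simp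
  then have "real (card A) \<le> real (nat \<lfloor>y\<rfloor>)"
    by (rule of_nat_mono)
  also have "\<dots> \<le> y"
    by (rule of_nat_floor) (simp add: y_def)
  finally have A: "real (card A) \<le> y" .
  have "real (card B) * ((1 - d) * ln (real n)) = (\<Sum>p\<in>B. (1 - d) * ln (real n))" by simp
  also have "\<dots> \<le> (\<Sum>p\<in>B. mangoldt p)"
  proof (rule sum_mono)
    fix p assume "p \<in> B"
    then have p: "prime p" "y < real p" by (auto simp: B_def primes_le_def)
    have "(1 - d) * ln (real n) = ln y"
      using n by (simp add: y_def ln_powr)
    also have "\<dots> \<le> ln (real p)"
      using p n by (intro ln_mono) (auto simp: y_def)
    finally show "(1 - d) * ln (real n) \<le> mangoldt p" using p by simp
  qed
  also have "\<dots> \<le> psi n"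
    unfolding psi_def by (rule sum_mono2) (auto simp: B_def primes_le_def mangoldt_nonneg)
  finally have "real (card B) \<le> psi n / ((1 - d) * ln (real n))"
    using d ln_n by (simp add: field_simps)
  with A card show ?thesis by (simp add: y_def)
qed

theorem prime_number_theorem_if_psi:
  assumes psi: "(\<lambda>n. psi n / real n) \<longlonglongrightarrow> 1"
  shows "(\<lambda>n. real (card (primes_le n)) * ln (real n) / real n) \<longlonglongrightarrow> 1"
proof (rule LIMSEQ_I)
  fix e :: real assume e: "e > 0"
  let ?q = "\<lambda>n. real (card (primes_le n)) * ln (real n) / real n"
  \<comment> \<open>Chosen so that \<open>1 / (1 - d) = 1 + e / 2\<close>.\<close>
  define d where "d = e / (2 + e)"
  have d: "0 < d" "d < 1" using e by (auto simp: d_def field_simps)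
  have "(\<lambda>n. ln (real n) * real n powr (- d)) \<longlonglongrightarrow> 0"
    using d by real_asymp
  then have "(\<lambda>n. ln (real n) * real n powr (- d) + (psi n / real n) / (1 - d)) \<longlonglongrightarrow> 0 + 1 / (1 - d)"
    using d by (intro tendsto_intros psi) auto
  moreover have "0 + 1 / (1 - d) < 1 + e"
    using e by (simp add: d_def field_simps)
  ultimately have "\<forall>\<^sub>F n in sequentially. ln (real n) * real n powr (- d) + (psi n / real n) / (1 - d) < 1 + e"
    by (rule order_tendstoD)
  moreover have "\<forall>\<^sub>F n in sequentially. psi n / real n > 1 - e"
    using psi e by (intro order_tendstoD(1)[OF psi]) auto
  ultimately have "\<forall>\<^sub>F n in sequentially. norm (?q n - 1) < e"
    using eventually_ge_at_top[of 2]
  proof eventually_elim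
    case (elim n)
    have "?q n \<le> (real n powr (1 - d) + psi n / ((1 - d) * ln (real n))) * ln (real n) / real n"
      using elim by (intro divide_right_mono mult_right_mono card_primes_le_le d) auto
    also have "\<dots> = ln (real n) * (real n powr (1 - d) / real n) + (psi n / real n) / (1 - d)"
      using elim d by (simp add: field_simps)
    also have "real n powr (1 - d) / real n = real n powr (- d)"
      using elim by (simp add: powr_diff powr_minus_divide)
    finally have "?q n < 1 + e" using elim by linarith
    moreover have "psi n / real n \<le> ?q n"
      by (intro divide_right_mono psi_le_card_primes) auto
    ultimately show ?case using elim by (simp add: abs_less_iff)
  qed
  then show "\<exists>no. \<forall>n\<ge>no. norm (?q n - 1) < e"
    by (simp add: eventually_at_top_linorder)
qed

section \<open>From the count of primes to the n-th prime and its iterates\<close>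

lemma infinite_prime_set: "infinite {p::nat. prime p}"
  by (rule primes_infinite)

lemma nth_prime_gt:
  assumes "n \<ge> 1"
  shows "nth_prime n > n"
proof -
  \<comment> \<open>Counting from \<open>0\<close>, the enumeration starts with the prime
    \<open>2\<close>; at \<open>k = n - 1\<close> the bound is \<open>n + 1\<close>.\<close>
  have "enumerate {p::nat. prime p} k \<ge> k + 2" for k
  proof (induction k)
    case 0
    have "enumerate {p::nat. prime p} 0 \<in> {p. prime p}"
      by (rule enumerate_in_set[OF infinite_prime_set])
    then have "prime (enumerate {p::nat. prime p} 0)" by blast
    from prime_ge_2_nat[OF this] show ?case by linarith
  next
    case (Suc k)
    with enumerate_step[OF infinite_prime_set, of k] show ?case by linarith
  qed
  from this[of "n - 1"] assms show ?thesis by (simp add: nth_prime_def)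
qed

text \<open>Evaluates the prime counting function along the primes, which turns its asymptotics into
  a relation between \<open>n\<close> and \<open>nth_prime n\<close>.\<close>

lemma card_primes_le_nth_prime:
  assumes "n \<ge> 1"
  shows "card (primes_le (nth_prime n)) = n"
proof -
  let ?e = "enumerate {p::nat. prime p}"
  note inf = infinite_prime_set
  have "primes_le (nth_prime n) = ?e ` {..n - 1}"
  proof (intro equalityI subsetI)
    fix p assume "p \<in> primes_le (nth_prime n)"
    then have p: "prime p" "p \<le> ?e (n - 1)" by (auto simp: primes_le_def nth_prime_def)
    then obtain k where "p = ?e k" using enumerate_Ex[OF inf, of p] by auto
    with p show "p \<in> ?e ` {..n - 1}" using enumerate_mono_le_iff[OF inf] by auto
  next
    fix p assume "p \<in> ?e ` {..n - 1}"
    then show "p \<in> primes_le (nth_prime n)"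
      using enumerate_mono_le_iff[OF inf] enumerate_in_set[OF inf] by (auto simp: primes_le_def nth_prime_def)
  qed
  also have "card \<dots> = card {..n - 1}"
    using inf by (intro card_image inj_onI) (metis enumerate_mono_le_iff order_antisym order_refl)
  finally show ?thesis using assms by simp
qed

text \<open>The prime number theorem at \<open>nth_prime n\<close> gives \<open>r n\<close>, with
  \<open>ln (nth_prime n)\<close> in place of \<open>ln n\<close>. Taking logarithms,
  \<open>ln n = ln (r n) + L - ln L\<close> for \<open>L = ln (nth_prime n)\<close>, so the ratio of
  the two logarithms tends to \<open>1\<close>.\<close>

theorem nth_prime_asymptotics_if_psi:
  assumes psi: "(\<lambda>n. psi n / real n) \<longlonglongrightarrow> 1"
  shows "(\<lambda>n. real (nth_prime n)) \<sim>[at_top] (\<lambda>n. real n * ln (real n))"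
proof -
  let ?p = "\<lambda>n. real (nth_prime n)"
  define r where "r = (\<lambda>n. real n * ln (?p n) / ?p n)"
  have "filterlim nth_prime at_top at_top"
    by (rule filterlim_at_top_mono[OF filterlim_ident])
       (auto intro!: eventually_at_top_linorderI[of 1] less_imp_le nth_prime_gt)
  then have p_top: "filterlim ?p at_top at_top"
    by (rule filterlim_compose[OF filterlim_real_sequentially])
  have "(\<lambda>n. real (card (primes_le (nth_prime n))) * ln (?p n) / ?p n) \<longlonglongrightarrow> 1"
    by (rule filterlim_compose[OF prime_number_theorem_if_psi[OF psi] \<open>filterlim nth_prime at_top at_top\<close>])
  moreover have "\<forall>\<^sub>F n in at_top. real (card (primes_le (nth_prime n))) * ln (?p n) / ?p n = r n"
    by (auto intro!: eventually_at_top_linorderI[of 1] simp: card_primes_le_nth_prime r_def)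
  ultimately have r: "r \<longlonglongrightarrow> 1"
    by (rule Lim_transform_eventually)
  have ll: "((\<lambda>x::real. ln (ln x) / ln x) \<longlongrightarrow> 0) at_top" and il: "((\<lambda>x::real. 1 / ln x) \<longlongrightarrow> 0) at_top"
    by real_asymp+
  \<comment> \<open>The inner bracket is \<open>ln n / ln (nth_prime n)\<close>, so the whole
    expression is the reciprocal of \<open>n * ln n / nth_prime n\<close>.\<close>
  have "(\<lambda>n. 1 / (r n * (1 + ln (r n) * (1 / ln (?p n)) - ln (ln (?p n)) / ln (?p n)))) \<longlonglongrightarrow> 1 / (1 * (1 + ln 1 * 0 - 0))"
    by (intro tendsto_intros r filterlim_compose[OF ll p_top] filterlim_compose[OF il p_top]) auto
  moreover have "\<forall>\<^sub>F n in at_top. 1 / (r n * (1 + ln (r n) * (1 / ln (?p n)) - ln (ln (?p n)) / ln (?p n))) = ?p n / (real n * ln (real n))"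
    using eventually_ge_at_top[of 2]
  proof eventually_elim
    case (elim n)
    define L where "L = ln (?p n)"
    have p: "?p n > real n" using nth_prime_gt[of n] elim by simp
    then have L: "L > 0" using elim by (simp add: L_def)
    have n_eq: "real n = r n * ?p n / L"
      using p L by (simp add: r_def L_def)
    have "r n > 0" using p L elim by (simp add: r_def L_def)
    have "ln (real n) = ln (r n * ?p n / L)" using n_eq by simp
    also have "\<dots> = ln (r n) + L - ln L"
      using \<open>r n > 0\<close> p L elim by (simp add: ln_div ln_mult L_def)
    finally have ln_n: "ln (real n) = ln (r n) + L - ln L" .
    have "1 + ln (r n) * (1 / L) - ln L / L = ln (real n) / L"
      using L by (simp add: ln_n field_simps)
    then have "1 / (r n * (1 + ln (r n) * (1 / L) - ln L / L)) = L / (r n * ln (real n))"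
      by simp
    also have "\<dots> = ?p n / (real n * ln (real n))"
      using L p elim by (simp add: r_def L_def)
    finally show ?case by (simp add: L_def)
  qed
  ultimately have "(\<lambda>n. ?p n / (real n * ln (real n))) \<longlonglongrightarrow> 1 / (1 * (1 + ln 1 * 0 - 0))"
    by (rule Lim_transform_eventually)
  then show ?thesis
    by (intro asymp_equivI') simp
qed

lemma iter_prime_ge:
  assumes "n \<ge> 1"
  shows "iter_prime k n \<ge> k + n"
proof (induction k)
  case (Suc k)
  have "iter_prime (Suc k) n = nth_prime (iter_prime k n)"
    by (simp add: iter_prime_def)
  also have "\<dots> > iter_prime k n"
    using Suc assms by (intro nth_prime_gt) linarith
  finally show ?case using Suc by linarith
qed (simp add: iter_prime_def)

theorem theorem4:
  fixes n :: nat
  assumes "n \<ge> 1"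
  shows "(\<lambda>k. real (iter_prime (Suc k) n)) \<sim>[at_top]
           (\<lambda>k. real (iter_prime k n) * ln (real (iter_prime k n)))"
proof -
  have "(\<lambda>m. psi m / real m) \<longlonglongrightarrow> 1"
    by (rule tendsto_1_if_summable_diff[OF psi_mono summable_Chebyshev_error])
  then have "(\<lambda>m. real (nth_prime m)) \<sim>[at_top] (\<lambda>m. real m * ln (real m))"
    by (rule nth_prime_asymptotics_if_psi)
  moreover have "filterlim (\<lambda>k. iter_prime k n) at_top at_top"
    by (rule filterlim_at_top_mono[OF filterlim_ident])
       (intro always_eventually allI order_trans[OF _ iter_prime_ge[OF assms]], simp)
  ultimately have "(\<lambda>k. real (nth_prime (iter_prime k n))) \<sim>[at_top]
      (\<lambda>k. real (iter_prime k n) * ln (real (iter_prime k n)))"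
    by (rule asymp_equiv_compose')
  then show ?thesis
    by (simp add: iter_prime_def)
qed

end
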